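(* Let $R$ be a totally ordered set, let $U=\bigoplus_{j\in J}\mathbb{I}\lceil b'_j,d'_j\rfloor$ and $V=\bigoplus_{i\in I}\mathbb{I}\lceil b_i,d_i\rfloor$ be persistence modules of finite type indexed by $R$ ($I,J$ finite), with $J$ and $I$ given standard orders for the pair $(U,V)$, and let $X$ be a matrix representing a morphism $\varphi\colon U\to V$. Let $P_I$ and $p'$ be the pivot data of $X$ defined in the context. Let $SX$ be obtained by ordered row reduction of $X$ and let $$d''_i=\begin{cases}b'_{p'(i)}&\text{if }i\in P_I\\ d_i&\text{if }i\in I\setminus P_I.\end{cases}$$ Reorder the rows of $S$ in reverse by $d''_i$ and reorder the columns by $b_i$. Perform ordered row reduction of $S$ with respect to these orders to obtain $\widetilde S$, and let $q'(i)$ be the column index of the pivot of $\widetilde S$ in row $i$. Then $b_{q'(i)}\le d''_i$ for each $i$, $\operatorname{coker}\varphi\cong\bigoplus_{i\in I}\mathbb{I}\lceil b_{q'(i)},d''_i\rfloor$, and (with respect to such an isomorphism) $\widetilde S$ represents the quotient map $V\to\operatorname{coker}\varphi$.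
   Context: Fix a field $F$; all vector spaces are over $F$. A persistence module indexed by $R$ is a functor from the poset $R$ to vector spaces; morphisms are natural transformations; direct sums, images, kernels, cokernels are pointwise. A cut of $R$ is a pair $c=(c^\downarrow,c^\uparrow)$ of (possibly empty) subsets with $c^\downarrow\cup c^\uparrow=R$ and $r_1<r_2$ for all $r_1\in c^\downarrow$, $r_2\in c^\uparrow$; cuts are ordered by inclusion of $c^\downarrow$. For cuts $b\le d$ (birth and death times), $\lceil b,d\rfloor=b^\uparrow\cap d^\downarrow$. The interval module $\mathbb{I}\lceil b,d\rfloor$ is $F$ at $t\in\lceil b,d\rfloor$ and $0$ elsewhere, with identity structure maps inside the interval and zero maps otherwise. Bars $b=d$ (zero modules) are allowed in decompositions, including that of $\operatorname{coker}\varphi$. Finite type means isomorphic to a finite direct sum of interval modules. Matrix representation: with respect to finite interval decompositions $A\cong\bigoplus_{j\in J}\mathbb{I}\lceil a'_j,c'_j\rfloor$ and $B\cong\bigoplus_{i\in I}\mathbb{I}\lceil a_i,c_i\rfloor$, a matrix $X=\{x_{i,j}\}$ over $F$ represents a morphism $\varphi\colon A\to B$ if $x_{i,j}=0$ whenever $a_i>a'_j$ or $c_i>c'_j$, and for all $i,j$ and all $t\in\lceil a_i,c_i\rfloor\cap\lceil a'_j,c'_j\rfloor$ the composite $\mathbb{I}\lceil a'_j,c'_j\rfloor_t\to A_t\xrightarrow{\varphi_t}B_t\to\mathbb{I}\lceil a_i,c_i\rfloor_t$ is multiplication by $x_{i,j}$. The $i,j$ position is trivial if $c_i\le a'_j$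 and nontrivial otherwise. Standard orders for $(U,V)$: total orders on $J$ and $I$ with $j<j'$ if $b'_j<b'_{j'}$ and $i<i'$ if $d_i>d_{i'}$ (ties arbitrary). Ordered row reduction of a matrix with ordered rows and columns: process rows from least to greatest. If the current row is zero, move on. Otherwise its first (least-column) nonzero entry is its pivot; add multiples of the current row to each greater row so that the entry in the pivot's column becomes zero; then move on. The result for $X$ is written $SX$, with $S$ (rows and columns indexed by $I$) the product of the corresponding elementary matrices (lower triangular with 1's on the diagonal). Pivot data: using the pivot positions of the reduction of $X$, $P_I\subseteq I$ is the set of $i$ such that row $i$ has a nontrivial pivot (a pivot at $(i,j)$ with $b'_j<d_i$), and for $i\in P_I$, $p'(i)\in J$ is the column index of the pivot in row $i$. Reordering of rows and columns is done by changing the orders on the index sets, not by renaming entries: ordering in reverse by $d''_i$ means $i<i'$ if $d''_i>d''_{i'}$; ordering by $b_i$ means $i<i'$ if $b_i<b_{i'}$; ties are arbitrary. Since $S$ is invertible, every row of $\widetilde S$ has a pivot (here "pivot" makes no triviality requirement). *)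

theory Defs
  imports "Jordan_Normal_Form.VS_Connect" "HOL-Algebra.AbelCoset"
begin

section \<open>Cuts and intervals\<close>

typedef (overloaded) 'r cut =
  "{(A :: 'r::linorder set, B). A \<union> B = UNIV \<and> (\<forall>x\<in>A. \<forall>y\<in>B. x < y)}"
  morphisms cut_pair Cut
  by (rule exI[of _ "({}, UNIV)"]) simp

definition lower :: "'r::linorder cut \<Rightarrow> 'r set" where
  "lower c = fst (cut_pair c)"

definition upper :: "'r::linorder cut \<Rightarrow> 'r set" where
  "upper c = snd (cut_pair c)"

lemma cut_union: "lower c \<union> upper c = UNIV"
  and cut_less: "x \<in> lower c \<Longrightarrow> y \<in> upper c \<Longrightarrow> x < y"
  using cut_pair[of c] by (auto simp: lower_def upper_def split: prod.splits)

lemma upper_eq: "upper c = - lower c"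
  using cut_union[of c] cut_less[of _ c] by blast

lemma cut_eqI: "lower c = lower d \<Longrightarrow> c = d"
  using upper_eq[of c] upper_eq[of d]
  by (metis cut_pair_inject lower_def upper_def prod.expand)

instantiation cut :: (linorder) linorder
begin

definition less_eq_cut :: "'a cut \<Rightarrow> 'a cut \<Rightarrow> bool" where
  "c \<le> d \<longleftrightarrow> lower c \<subseteq> lower d"

definition less_cut :: "'a cut \<Rightarrow> 'a cut \<Rightarrow> bool" where
  "c < d \<longleftrightarrow> lower c \<subset> lower d"

instance
proof
  fix c d :: "'a cut"
  show "c \<le> d \<or> d \<le> c"
  proof (rule ccontr)
    assume "\<not> ?thesis"
    then obtain x y where "x \<in> lower c" "x \<in> upper d" "y \<in> lower d" "y \<in> upper c"
      by (auto simp: less_eq_cut_def upper_eq)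
    then have "x < y" "y < x" by (auto intro: cut_less)
    then show False by simp
  qed
qed (auto simp: less_eq_cut_def less_cut_def intro: cut_eqI)

end

definition interval :: "'r::linorder cut \<Rightarrow> 'r cut \<Rightarrow> 'r set" where
  "interval b d = upper b \<inter> lower d"


section \<open>Persistence modules\<close>

text \<open>Vector spaces over the type \<open>'f\<close> are carrier-based, with \<open>class_ring\<close> as the
  field; the fields \<^const>\<open>monoid.mult\<close> and \<^const>\<open>monoid.one\<close> of the module record play no role.
  Families of maps only matter on the carriers, and structure maps only for \<open>s \<le> t\<close>.\<close>

record ('r, 'f, 'v) pmod =
  fibre :: "'r \<Rightarrow> ('f, 'v) module"
  smap :: "'r \<Rightarrow> 'r \<Rightarrow> 'v \<Rightarrow> 'v"

definition persistence_module :: "('r::linorder, 'f::field, 'v) pmod \<Rightarrow> bool" where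
  "persistence_module M \<longleftrightarrow>
     (\<forall>t. vectorspace class_ring (fibre M t)) \<and>
     (\<forall>s t. s \<le> t \<longrightarrow> smap M s t \<in> LinearCombinations.module_hom class_ring (fibre M s) (fibre M t)) \<and>
     (\<forall>t. \<forall>v\<in>carrier (fibre M t). smap M t t v = v) \<and>
     (\<forall>r s t. r \<le> s \<longrightarrow> s \<le> t \<longrightarrow>
        (\<forall>v\<in>carrier (fibre M r). smap M s t (smap M r s v) = smap M r t v))"

definition pers_hom ::
  "('r::linorder, 'f::field, 'v) pmod \<Rightarrow> ('r, 'f, 'w) pmod \<Rightarrow> ('r \<Rightarrow> 'v \<Rightarrow> 'w) \<Rightarrow> bool" where
  "pers_hom M N \<phi> \<longleftrightarrow>
     persistence_module M \<and> persistence_module N \<and>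
     (\<forall>t. \<phi> t \<in> LinearCombinations.module_hom class_ring (fibre M t) (fibre N t)) \<and>
     (\<forall>s t. s \<le> t \<longrightarrow> (\<forall>v\<in>carrier (fibre M s). \<phi> t (smap M s t v) = smap N s t (\<phi> s v)))"

definition pers_iso ::
  "('r::linorder, 'f::field, 'v) pmod \<Rightarrow> ('r, 'f, 'w) pmod \<Rightarrow> ('r \<Rightarrow> 'v \<Rightarrow> 'w) \<Rightarrow> bool" where
  "pers_iso M N \<phi> \<longleftrightarrow>
     pers_hom M N \<phi> \<and> (\<forall>t. bij_betw (\<phi> t) (carrier (fibre M t)) (carrier (fibre N t)))"

definition interval_module :: "'r::linorder cut \<Rightarrow> 'r cut \<Rightarrow> ('r, 'f::field, 'f) pmod" where
  "interval_module b d =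
     \<lparr>fibre = (\<lambda>t. \<lparr>carrier = (if t \<in> interval b d then UNIV else {0}),
                    monoid.mult = undefined, one = undefined,
                    zero = 0, add = (+), smult = (*)\<rparr>),
      smap = (\<lambda>s t x. if s \<in> interval b d \<and> t \<in> interval b d then x else 0)\<rparr>"

definition pers_sum :: "'k set \<Rightarrow> ('k \<Rightarrow> ('r, 'f, 'v) pmod) \<Rightarrow> ('r, 'f, 'k \<Rightarrow> 'v) pmod" where
  "pers_sum K M =
     \<lparr>fibre = (\<lambda>t. \<lparr>carrier = {v \<in> \<Pi>\<^sub>E k\<in>K. carrier (fibre (M k) t).
                                finite {k\<in>K. v k \<noteq> \<zero>\<^bsub>fibre (M k) t\<^esub>}},
                    monoid.mult = undefined, one = undefined,
                    zero = (\<lambda>k\<in>K. \<zero>\<^bsub>fibre (M k) t\<^esub>),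
                    add = (\<lambda>v w. \<lambda>k\<in>K. v k \<oplus>\<^bsub>fibre (M k) t\<^esub> w k),
                    smult = (\<lambda>a v. \<lambda>k\<in>K. a \<odot>\<^bsub>fibre (M k) t\<^esub> v k)\<rparr>),
      smap = (\<lambda>s t v. \<lambda>k\<in>K. smap (M k) s t (v k))\<rparr>"

definition pers_sum_incl ::
  "'k set \<Rightarrow> ('k \<Rightarrow> ('r, 'f, 'v) pmod) \<Rightarrow> 'r \<Rightarrow> 'k \<Rightarrow> 'v \<Rightarrow> 'k \<Rightarrow> 'v" where
  "pers_sum_incl K M t j x = (\<lambda>k\<in>K. if k = j then x else \<zero>\<^bsub>fibre (M k) t\<^esub>)"

text \<open>The cokernel consists of the quotient spaces \<open>V\<^sub>t / im \<phi>\<^sub>t\<close>, whose elements are cosets.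
  Scalar multiplication and structure maps take the common value over all representatives of
  a coset.\<close>

definition pers_image :: "('r, 'f, 'u) pmod \<Rightarrow> ('r \<Rightarrow> 'u \<Rightarrow> 'v) \<Rightarrow> 'r \<Rightarrow> 'v set" where
  "pers_image U \<phi> t = \<phi> t ` carrier (fibre U t)"

definition quotient_map ::
  "('r, 'f, 'u) pmod \<Rightarrow> ('r, 'f, 'v) pmod \<Rightarrow> ('r \<Rightarrow> 'u \<Rightarrow> 'v) \<Rightarrow> 'r \<Rightarrow> 'v \<Rightarrow> 'v set" where
  "quotient_map U V \<phi> t v = pers_image U \<phi> t +>\<^bsub>fibre V t\<^esub> v"

definition coker ::
  "('r, 'f, 'u) pmod \<Rightarrow> ('r, 'f, 'v) pmod \<Rightarrow> ('r \<Rightarrow> 'u \<Rightarrow> 'v) \<Rightarrow> ('r, 'f, 'v set) pmod" where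
  "coker U V \<phi> =
     \<lparr>fibre = (\<lambda>t. \<lparr>carrier = a_rcosets\<^bsub>fibre V t\<^esub> (pers_image U \<phi> t),
                    monoid.mult = undefined, one = undefined,
                    zero = pers_image U \<phi> t,
                    add = set_add (fibre V t),
                    smult = (\<lambda>a C. the_elem
                      ((\<lambda>v. quotient_map U V \<phi> t (a \<odot>\<^bsub>fibre V t\<^esub> v)) ` C))\<rparr>),
      smap = (\<lambda>s t C. the_elem ((\<lambda>v. quotient_map U V \<phi> t (smap V s t v)) ` C))\<rparr>"


section \<open>Interval decompositions and matrix representations\<close>

abbreviation interval_sum ::
  "'k set \<Rightarrow> ('k \<Rightarrow> 'r::linorder cut) \<Rightarrow> ('k \<Rightarrow> 'r cut) \<Rightarrow> ('r, 'f::field, 'k \<Rightarrow> 'f) pmod" where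
  "interval_sum K a c \<equiv> pers_sum K (\<lambda>k. interval_module (a k) (c k))"

definition interval_decomposition ::
  "('r::linorder, 'f::field, 'v) pmod \<Rightarrow> 'k set \<Rightarrow> ('k \<Rightarrow> 'r cut) \<Rightarrow> ('k \<Rightarrow> 'r cut) \<Rightarrow>
   ('r \<Rightarrow> 'v \<Rightarrow> 'k \<Rightarrow> 'f) \<Rightarrow> bool" where
  "interval_decomposition A K a c \<alpha> \<longleftrightarrow>
     finite K \<and> (\<forall>k\<in>K. a k \<le> c k) \<and> pers_iso A (interval_sum K a c) \<alpha>"

definition matrix_represents ::
  "('r::linorder, 'f::field, 'v) pmod \<Rightarrow> 'j set \<Rightarrow> ('j \<Rightarrow> 'r cut) \<Rightarrow> ('j \<Rightarrow> 'r cut) \<Rightarrow>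
     ('r \<Rightarrow> 'v \<Rightarrow> 'j \<Rightarrow> 'f) \<Rightarrow>
   ('r, 'f, 'w) pmod \<Rightarrow> 'i set \<Rightarrow> ('i \<Rightarrow> 'r cut) \<Rightarrow> ('i \<Rightarrow> 'r cut) \<Rightarrow>
     ('r \<Rightarrow> 'w \<Rightarrow> 'i \<Rightarrow> 'f) \<Rightarrow>
   ('r \<Rightarrow> 'v \<Rightarrow> 'w) \<Rightarrow> ('i \<Rightarrow> 'j \<Rightarrow> 'f) \<Rightarrow> bool" where
  "matrix_represents A J a' c' \<alpha> B I a c \<beta> \<phi> X \<longleftrightarrow>
     interval_decomposition A J a' c' \<alpha> \<and>
     interval_decomposition B I a c \<beta> \<and>
     pers_hom A B \<phi> \<and>
     (\<forall>i\<in>I. \<forall>j\<in>J. a i > a' j \<or> c i > c' j \<longrightarrow> X i j = 0) \<and>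
     (\<forall>i\<in>I. \<forall>j\<in>J. \<forall>t \<in> interval (a i) (c i) \<inter> interval (a' j) (c' j). \<forall>x :: 'f.
        \<beta> t (\<phi> t (inv_into (carrier (fibre A t)) (\<alpha> t)
          (pers_sum_incl J (\<lambda>k. interval_module (a' k) (c' k)) t j x))) i = X i j * x)"


section \<open>Orders on index sets and ordered row reduction\<close>

text \<open>Orders are reflexive; ties may be broken arbitrarily.\<close>

definition ordered_by :: "'k set \<Rightarrow> ('k \<Rightarrow> 'a::linorder) \<Rightarrow> 'k rel \<Rightarrow> bool" where
  "ordered_by K f r \<longleftrightarrow>
     linear_order_on K r \<and> (\<forall>k\<in>K. \<forall>k'\<in>K. f k < f k' \<longrightarrow> (k, k') \<in> r)"

definition reverse_ordered_by :: "'k set \<Rightarrow> ('k \<Rightarrow> 'a::linorder) \<Rightarrow> 'k rel \<Rightarrow> bool" where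
  "reverse_ordered_by K f r \<longleftrightarrow>
     linear_order_on K r \<and> (\<forall>k\<in>K. \<forall>k'\<in>K. f k > f k' \<longrightarrow> (k, k') \<in> r)"

definition enumeration :: "'k set \<Rightarrow> 'k rel \<Rightarrow> 'k list" where
  "enumeration K r = (THE ks. set ks = K \<and> distinct ks \<and> sorted_wrt (\<lambda>k k'. (k, k') \<in> r) ks)"

definition mat_mult ::
  "'k set \<Rightarrow> ('i \<Rightarrow> 'k \<Rightarrow> 'f::field) \<Rightarrow> ('k \<Rightarrow> 'j \<Rightarrow> 'f) \<Rightarrow> 'i \<Rightarrow> 'j \<Rightarrow> 'f" where
  "mat_mult K A B i j = (\<Sum>k\<in>K. A i k * B k j)"

definition id_mat :: "'i \<Rightarrow> 'i \<Rightarrow> 'f::field" where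
  "id_mat k l = (if k = l then 1 else 0)"

text \<open>Left multiplication by this matrix adds \<open>x\<close> times row \<open>i\<close> to row \<open>i' \<noteq> i\<close>.\<close>

definition add_row_mat :: "'i \<Rightarrow> 'i \<Rightarrow> 'f \<Rightarrow> 'i \<Rightarrow> 'i \<Rightarrow> 'f::field" where
  "add_row_mat i i' x k l = (if k = i' \<and> l = i then x else id_mat k l)"

definition has_pivot :: "'j set \<Rightarrow> ('i \<Rightarrow> 'j \<Rightarrow> 'f::field) \<Rightarrow> 'i \<Rightarrow> bool" where
  "has_pivot J M i \<longleftrightarrow> (\<exists>j\<in>J. M i j \<noteq> 0)"

definition pivot :: "'j set \<Rightarrow> 'j rel \<Rightarrow> ('i \<Rightarrow> 'j \<Rightarrow> 'f::field) \<Rightarrow> 'i \<Rightarrow> 'j" where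
  "pivot J rJ M i = (THE j. j \<in> J \<and> M i j \<noteq> 0 \<and> (\<forall>j'\<in>J. M i j' \<noteq> 0 \<longrightarrow> (j, j') \<in> rJ))"

definition elimination_mat ::
  "'j set \<Rightarrow> 'j rel \<Rightarrow> ('i \<Rightarrow> 'j \<Rightarrow> 'f::field) \<Rightarrow> 'i \<Rightarrow> 'i \<Rightarrow> 'i \<Rightarrow> 'i \<Rightarrow> 'f" where
  "elimination_mat J rJ M i i' =
     (if has_pivot J M i
      then add_row_mat i i' (- M i' (pivot J rJ M i) / M i (pivot J rJ M i))
      else id_mat)"

text \<open>The elimination steps run through the pairs \<open>(i, i')\<close> with \<open>i\<close> strictly before \<open>i'\<close>,
  in lexicographic order. The state is the product \<open>S\<close> of the elementary matrices so far, so the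
  current matrix is \<open>S X\<close>; row \<open>i\<close> itself does not change while it is being processed.\<close>

definition reduction_mat ::
  "'i set \<Rightarrow> 'i rel \<Rightarrow> 'j set \<Rightarrow> 'j rel \<Rightarrow> ('i \<Rightarrow> 'j \<Rightarrow> 'f::field) \<Rightarrow> 'i \<Rightarrow> 'i \<Rightarrow> 'f" where
  "reduction_mat I rI J rJ X =
     fold (\<lambda>(i, i') S. mat_mult I (elimination_mat J rJ (mat_mult I S X) i i') S)
       [(i, i'). i \<leftarrow> enumeration I rI, i' \<leftarrow> enumeration I rI, i \<noteq> i' \<and> (i, i') \<in> rI]
       id_mat"

definition row_reduced ::
  "'i set \<Rightarrow> 'i rel \<Rightarrow> 'j set \<Rightarrow> 'j rel \<Rightarrow> ('i \<Rightarrow> 'j \<Rightarrow> 'f::field) \<Rightarrow> 'i \<Rightarrow> 'j \<Rightarrow> 'f" where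
  "row_reduced I rI J rJ X = mat_mult I (reduction_mat I rI J rJ X) X"

end

theory Submission
  imports Defs
begin

text \<open>
  Fix a time \<open>x\<close> and put \<open>F\<^sub>x = span {e\<^sub>k | b\<^sub>k \<le> x}\<close> and
  \<open>D\<^sub>x = span ({X e\<^sub>j | b'\<^sub>j \<le> x} \<union> {e\<^sub>k | d\<^sub>k \<le> x})\<close>. Since
  \<open>V\<^sub>x = F\<^sub>x / span {e\<^sub>k | d\<^sub>k \<le> x}\<close> and a column \<open>j\<close> that is already dead at \<open>x\<close> only
  involves rows that are dead as well, the cokernel at \<open>x\<close> is \<open>F\<^sub>x / D\<^sub>x\<close>.

  A triangular matrix preserves the span of a final segment of rows, and the columns in an initial
  segment \<open>L\<close> of a reduced matrix span exactly the \<open>e\<^sub>i\<close> whose row has its pivot in \<open>L\<close>. Hence \<open>S\<close>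
  maps \<open>D\<^sub>x\<close> onto \<open>span {e\<^sub>i | d''\<^sub>i \<le> x}\<close>. The second reduction multiplies \<open>S\<close> by a matrix that is
  triangular for the order by \<open>d''\<close>, so \<open>S'\<close> still maps \<open>D\<^sub>x\<close> onto this span, and being reduced it
  maps \<open>F\<^sub>x\<close> onto \<open>span {e\<^sub>i | b (q' i) \<le> x}\<close>. Thus \<open>S'\<close> induces the isomorphism of \<open>F\<^sub>x / D\<^sub>x\<close>
  with the span of those \<open>e\<^sub>i\<close> for which \<open>b (q' i) \<le> x < d''\<^sub>i\<close>.
\<close>

section \<open>Finite linear orders and ordered row reduction\<close>

lemma linear_order_onD:
  assumes "linear_order_on K r"
  shows linear_order_refl: "k \<in> K \<Longrightarrow> (k, k) \<in> r"
    and linear_order_antisym: "(k, l) \<in> r \<Longrightarrow> (l, k) \<in> r \<Longrightarrow> k = l"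
    and linear_order_trans: "(k, l) \<in> r \<Longrightarrow> (l, m) \<in> r \<Longrightarrow> (k, m) \<in> r"
    and linear_order_total: "k \<in> K \<Longrightarrow> l \<in> K \<Longrightarrow> (k, l) \<in> r \<or> (l, k) \<in> r"
  using assms
  unfolding linear_order_on_def partial_order_on_def preorder_on_def refl_on_def total_on_def
  by (auto dest: antisymD transD) (metis)

text \<open>Induction on the number of predecessors, which drops strictly when passing to an earlier
  element. It drives the substitution and column span arguments below.\<close>

lemma linear_order_induct [consumes 3, case_names less]:
  assumes K: "finite K" and r: "linear_order_on K r" and "k \<in> K"
    and step: "\<And>k. k \<in> K \<Longrightarrow> (\<And>l. l \<in> K \<Longrightarrow> l \<noteq> k \<Longrightarrow> (l, k) \<in> r \<Longrightarrow> P l) \<Longrightarrow> P k"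
  shows "P k"
  using \<open>k \<in> K\<close>
proof (induction "card {l\<in>K. (l, k) \<in> r}" arbitrary: k rule: less_induct)
  case less
  show ?case
  proof (rule step[OF less.prems])
    fix l assume l: "l \<in> K" "l \<noteq> k" "(l, k) \<in> r"
    have "{m\<in>K. (m, l) \<in> r} \<subset> {m\<in>K. (m, k) \<in> r}"
      using l less.prems linear_order_refl[OF r less.prems] linear_order_antisym[OF r]
        linear_order_trans[OF r] by blast
    then show "P l"
      using less.hyps l K by (simp add: psubset_card_mono)
  qed
qed

lemma linear_order_least:
  assumes K: "finite K" and r: "linear_order_on K r" and A: "A \<subseteq> K" "A \<noteq> {}"
  obtains a where "a \<in> A" "\<And>k. k \<in> A \<Longrightarrow> (a, k) \<in> r"
proof -
  have "\<exists>a\<in>A. \<forall>k\<in>A. (a, k) \<in> r" if "k \<in> K" "k \<in> A" for k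
    using K r that
  proof (induction k rule: linear_order_induct)
    case (less k)
    then show ?case
      using A linear_order_total[OF r] linear_order_refl[OF r] by (metis subsetD)
  qed
  then show thesis
    using A that by blast
qed

text \<open>\<open>THE\<close> is meaningful only after existence and uniqueness. Both follow by
  induction over the subsets of \<open>K\<close>: a sorted list must start with the least element,
  and its tail enumerates what remains.\<close>

lemma enumeration:
  assumes K: "finite K" and r: "linear_order_on K r"
  shows "set (enumeration K r) = K \<and> distinct (enumeration K r) \<and>
    sorted_wrt (\<lambda>k k'. (k, k') \<in> r) (enumeration K r)"
proof -
  let ?P = "\<lambda>A ks. set ks = A \<and> distinct ks \<and> sorted_wrt (\<lambda>k k'. (k, k') \<in> r) ks"
  have ex: "\<exists>!ks. ?P A ks" if "A \<subseteq> K" for A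
    using finite_subset[OF that K] that
  proof (induction A rule: finite_psubset_induct)
    case (psubset A)
    show ?case
    proof (cases "A = {}")
      case False
      then obtain a where a: "a \<in> A" "\<And>k. k \<in> A \<Longrightarrow> (a, k) \<in> r"
        using linear_order_least[OF K r] psubset.prems by metis
      have "\<exists>!ks. ?P (A - {a}) ks"
        using a psubset.prems by (intro psubset.IH) auto
      then obtain ks where ks: "?P (A - {a}) ks" and uniq: "\<And>ls. ?P (A - {a}) ls \<Longrightarrow> ls = ks"
        by auto
      show ?thesis
      proof (intro ex1I[of _ "a # ks"])
        show "?P A (a # ks)" using ks a by auto
        fix ls assume ls: "?P A ls"
        then obtain l ls' where eq: "ls = l # ls'" using a by (cases ls) auto
        have "l = a"
          using ls a eq linear_order_antisym[OF r] by (metis list.set_intros(1) set_ConsD sorted_wrt.simps(2))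
        then have "?P (A - {a}) ls'" using ls eq by auto
        then show "ls = a # ks" using uniq eq \<open>l = a\<close> by simp
      qed
    qed auto
  qed
  show ?thesis
    unfolding enumeration_def using theI'[OF ex[OF subset_refl]] .
qed

section \<open>Pivots, elimination steps and the invariant of the reduction\<close>

definition unitriangular :: "'k set \<Rightarrow> 'k rel \<Rightarrow> ('k \<Rightarrow> 'k \<Rightarrow> 'f::field) \<Rightarrow> bool" where
  "unitriangular K r A \<longleftrightarrow>
     (\<forall>k\<in>K. A k k = 1) \<and> (\<forall>k\<in>K. \<forall>l\<in>K. A k l \<noteq> 0 \<longrightarrow> (l, k) \<in> r)"

text \<open>Weaker than a staircase: rows are never exchanged, so pivot columns need not increase
  from row to row and zero rows may stand anywhere. Pivot columns of different rows are still
  different.\<close>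

definition row_echelon ::
  "'i set \<Rightarrow> 'i rel \<Rightarrow> 'j set \<Rightarrow> 'j rel \<Rightarrow> ('i \<Rightarrow> 'j \<Rightarrow> 'f::field) \<Rightarrow> bool" where
  "row_echelon I rI J rJ M \<longleftrightarrow> (\<forall>i\<in>I. \<forall>i'\<in>I.
     i \<noteq> i' \<longrightarrow> (i, i') \<in> rI \<longrightarrow> has_pivot J M i \<longrightarrow> M i' (pivot J rJ M i) = 0)"

lemma has_pivot_cong:
  "(\<And>j. j \<in> J \<Longrightarrow> M i j = M' i j) \<Longrightarrow> has_pivot J M i \<longleftrightarrow> has_pivot J M' i"
  by (auto simp: has_pivot_def)

lemma pivot_cong:
  "(\<And>j. j \<in> J \<Longrightarrow> M i j = M' i j) \<Longrightarrow> pivot J rJ M i = pivot J rJ M' i"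
  unfolding pivot_def by (rule arg_cong[where f = The]) (auto simp: fun_eq_iff)

lemma pivot:
  assumes J: "finite J" and rJ: "linear_order_on J rJ" and "has_pivot J M i"
  shows pivot_in: "pivot J rJ M i \<in> J"
    and pivot_nonzero: "M i (pivot J rJ M i) \<noteq> 0"
    and pivot_least: "j \<in> J \<Longrightarrow> M i j \<noteq> 0 \<Longrightarrow> (pivot J rJ M i, j) \<in> rJ"
proof -
  let ?P = "\<lambda>j. j \<in> J \<and> M i j \<noteq> 0 \<and> (\<forall>j'\<in>J. M i j' \<noteq> 0 \<longrightarrow> (j, j') \<in> rJ)"
  obtain a where "a \<in> {j\<in>J. M i j \<noteq> 0}" "\<And>j. j \<in> {j\<in>J. M i j \<noteq> 0} \<Longrightarrow> (a, j) \<in> rJ"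
    using linear_order_least[OF J rJ, of "{j\<in>J. M i j \<noteq> 0}"] assms(3) unfolding has_pivot_def by auto
  then have "?P a" by auto
  moreover have "j = a" if "?P j" for j
    using that \<open>?P a\<close> linear_order_antisym[OF rJ] by blast
  ultimately have "?P (pivot J rJ M i)"
    unfolding pivot_def by (rule theI)
  then show "pivot J rJ M i \<in> J" "M i (pivot J rJ M i) \<noteq> 0"
    "j \<in> J \<Longrightarrow> M i j \<noteq> 0 \<Longrightarrow> (pivot J rJ M i, j) \<in> rJ" by auto
qed

lemma mat_mult_assoc:
  "finite K \<Longrightarrow> finite L \<Longrightarrow> mat_mult L (mat_mult K A B) C = mat_mult K A (mat_mult L B C)"
  unfolding mat_mult_def fun_eq_iff
  by (auto simp: sum_distrib_left sum_distrib_right mult.assoc intro: sum.swap)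

lemma mat_mult_id:
  assumes "finite I" "i \<in> I"
  shows "mat_mult I id_mat S i l = S i l"
proof -
  have "mat_mult I id_mat S i l = (\<Sum>k\<in>I. if i = k then S k l else 0)"
    unfolding mat_mult_def id_mat_def by (rule sum.cong) auto
  then show ?thesis using assms by simp
qed

lemma mat_mult_add_row:
  assumes I: "finite I" "i \<in> I" "k \<in> I" and "i \<noteq> i'"
  shows "mat_mult I (add_row_mat i i' x) S k l = S k l + (if k = i' then x * S i l else 0)"
proof -
  have "mat_mult I (add_row_mat i i' x) S k l
    = (\<Sum>m\<in>I. (if k = m then S m l else 0) + (if m = i then (if k = i' then x * S i l else 0) else 0))"
    unfolding mat_mult_def add_row_mat_def id_mat_def using assms by (intro sum.cong) auto
  then show ?thesis using I by (simp add: sum.distrib)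
qed

text \<open>Hides the case split on whether row \<open>i\<close> has a pivot; without one the factor
  is 0. Its exact value matters only for the entry that the step is meant to clear.\<close>

lemma elimination_step:
  assumes "finite I" "i \<in> I" "k \<in> I" "i \<noteq> i'"
  obtains x where "\<And>l. mat_mult I (elimination_mat J rJ M i i') S k l = S k l + (if k = i' then x * S i l else 0)"
proof (cases "has_pivot J M i")
  case True
  then show ?thesis
    by (intro that) (simp only: elimination_mat_def if_P mat_mult_add_row[OF assms])
next
  case False
  then show ?thesis
    by (intro that[of 0]) (simp add: elimination_mat_def mat_mult_id[OF assms(1,3)])
qed

text \<open>Row \<open>i\<close> is supported on columns up to \<open>i\<close>, which lie strictly
  before \<open>i'\<close>; adding a multiple of it to row \<open>i'\<close> neither leaves the
  triangle nor touches the diagonal.\<close>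

lemma unitriangular_elimination:
  assumes I: "finite I" and r: "linear_order_on I rI" and i: "i \<in> I" "i' \<in> I" "i \<noteq> i'" "(i, i') \<in> rI"
    and S: "unitriangular I rI S"
  shows "unitriangular I rI (mat_mult I (elimination_mat J rJ M i i') S)"
proof -
  have *: "S i l \<noteq> 0 \<Longrightarrow> l \<in> I \<Longrightarrow> (l, i') \<in> rI" for l
    using S i linear_order_trans[OF r] unfolding unitriangular_def by blast
  have **: "S i i' = 0"
    using S i linear_order_antisym[OF r] unfolding unitriangular_def by blast
  show ?thesis
    unfolding unitriangular_def
  proof (intro conjI ballI impI)
    fix k assume k: "k \<in> I"
    obtain x where x: "\<And>l. mat_mult I (elimination_mat J rJ M i i') S k l = S k l + (if k = i' then x * S i l else 0)"
      using elimination_step[OF I i(1) k i(3)] by metis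
    show "mat_mult I (elimination_mat J rJ M i i') S k k = 1"
      using S k ** unfolding x unitriangular_def by auto
    fix l assume l: "l \<in> I" "mat_mult I (elimination_mat J rJ M i i') S k l \<noteq> 0"
    then show "(l, k) \<in> rI"
      using S k * unfolding x unitriangular_def by (cases "S k l = 0") (auto split: if_splits)
  qed
qed

text \<open>Loop invariant of the reduction, with \<open>Q\<close> the pairs processed so far; for
  the full set of pairs it becomes \<open>row_echelon\<close>.\<close>

definition cleared ::
  "('i \<times> 'i) set \<Rightarrow> 'j set \<Rightarrow> 'j rel \<Rightarrow> ('i \<Rightarrow> 'j \<Rightarrow> 'f::field) \<Rightarrow> bool" where
  "cleared Q J rJ M \<longleftrightarrow>
     (\<forall>(i, i')\<in>Q. has_pivot J M i \<longrightarrow> M i' (pivot J rJ M i) = 0)"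

text \<open>Only row \<open>i'\<close> changes, and it is not yet the source of any pair in
  \<open>Q\<close>, so earlier pivots stay where they are. A zero of row \<open>i'\<close> in the
  pivot column of an earlier source \<open>k\<close> survives because row \<open>i\<close> was
  cleared there too: this is the third condition on \<open>Q\<close>.\<close>

lemma cleared_elimination:
  assumes I: "finite I" and J: "finite J" "linear_order_on J rJ" and i: "i \<in> I" "i' \<in> I" "i \<noteq> i'"
    and M: "cleared Q J rJ M"
    and Q: "Q \<subseteq> I \<times> I" "\<And>k k'. (k, k') \<in> Q \<Longrightarrow> k \<noteq> i'"
      "\<And>k. (k, i') \<in> Q \<Longrightarrow> k = i \<or> (k, i) \<in> Q"
  shows "cleared (insert (i, i') Q) J rJ (mat_mult I (elimination_mat J rJ M i i') M)"
proof -
  let ?M = "mat_mult I (elimination_mat J rJ M i i') M"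
  have other: "?M k l = M k l" if "k \<in> I" "k \<noteq> i'" for k l
    by (rule elimination_step[OF I i(1) that(1) i(3), of J rJ M M]) (use that in simp)
  have piv: "pivot J rJ ?M k = pivot J rJ M k" "has_pivot J ?M k = has_pivot J M k"
    if "k \<in> I" "k \<noteq> i'" for k
    using other[OF that] by (auto intro!: pivot_cong has_pivot_cong)
  have new: "?M i' (pivot J rJ M i) = 0" if "has_pivot J M i"
    using that i pivot_nonzero[OF J that]
    by (simp add: elimination_mat_def mat_mult_add_row[OF I])
  have "?M k' (pivot J rJ ?M k) = 0" if k: "(k, k') \<in> Q" "has_pivot J ?M k" for k k'
  proof -
    have kI: "k \<in> I" "k' \<in> I" "k \<noteq> i'" using k Q(1,2) by auto
    have p: "has_pivot J M k" "pivot J rJ ?M k = pivot J rJ M k" using piv[OF kI(1,3)] k by auto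
    have zero: "M k' (pivot J rJ M k) = 0" using M k p unfolding cleared_def by auto
    show ?thesis
    proof (cases "k' = i'")
      case False
      then show ?thesis using zero other[OF kI(2)] p by simp
    next
      case True
      show ?thesis
      proof (cases "k = i")
        case True
        then show ?thesis using new p \<open>k' = i'\<close> by simp
      next
        case False
        then have i_zero: "M i (pivot J rJ M k) = 0"
          using Q(3)[of k] k \<open>k' = i'\<close> M p unfolding cleared_def by auto
        show ?thesis
          by (rule elimination_step[OF I i(1) kI(2) i(3), of J rJ M M]) (use zero p i_zero in simp)
      qed
    qed
  qed
  moreover have "?M i' (pivot J rJ ?M i) = 0" if "has_pivot J ?M i"
    using that new piv[OF i(1,3)] by simp
  ultimately show ?thesis unfolding cleared_def by auto
qed

lemma reduction_mat:
  assumes I: "finite I" "linear_order_on I rI" and J: "finite J" "linear_order_on J rJ"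
  shows unitriangular_reduction_mat: "unitriangular I rI (reduction_mat I rI J rJ X)" (is ?t1)
    and row_echelon_row_reduced: "row_echelon I rI J rJ (row_reduced I rI J rJ X)" (is ?t2)
proof -
  define ks where "ks = enumeration I rI"
  have ks: "set ks = I" "sorted_wrt (\<lambda>k k'. (k, k') \<in> rI) ks"
    using enumeration[OF I] by (auto simp: ks_def)
  define pairs where "pairs = [(i, i'). i \<leftarrow> ks, i' \<leftarrow> ks, i \<noteq> i' \<and> (i, i') \<in> rI]"
  define f where "f = (\<lambda>(i, i') S. mat_mult I (elimination_mat J rJ (mat_mult I S X) i i') S)"
  have set_pairs: "set pairs = {(i, i'). i \<in> I \<and> i' \<in> I \<and> i \<noteq> i' \<and> (i, i') \<in> rI}"
    using ks by (auto simp: pairs_def split: if_splits)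
  have sorted_row: "sorted_wrt (\<lambda>(i, _) (k, _). (i, k) \<in> rI)
      [(i, i'). i' \<leftarrow> ls, i \<noteq> i' \<and> (i, i') \<in> rI]" if "i \<in> I" for i ls
    using linear_order_refl[OF I(2) that] by (induction ls) (auto simp: sorted_wrt_append)
  \<comment> \<open>The part of the lexicographic order that the invariant uses: first components
    never decrease.\<close>
  have sorted_pairs: "sorted_wrt (\<lambda>(i, _) (k, _). (i, k) \<in> rI) pairs"
  proof -
    have "sorted_wrt (\<lambda>(i, _) (k, _). (i, k) \<in> rI) [(i, i'). i \<leftarrow> ls, i' \<leftarrow> ks, i \<noteq> i' \<and> (i, i') \<in> rI]"
      if "set ls \<subseteq> I" "sorted_wrt (\<lambda>k k'. (k, k') \<in> rI) ls" for ls
      using that sorted_row by (induction ls) (auto simp: sorted_wrt_append split: if_splits)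
    then show ?thesis unfolding pairs_def using ks by blast
  qed
  have "unitriangular I rI (fold f xs id_mat) \<and> cleared (set xs) J rJ (mat_mult I (fold f xs id_mat) X)"
    if "pairs = xs @ ys" for xs ys
    using that
  proof (induction xs arbitrary: ys rule: rev_induct)
    case Nil
    show ?case
      using linear_order_refl[OF I(2)] by (auto simp: unitriangular_def id_mat_def cleared_def split: if_splits)
  next
    case (snoc p xs)
    obtain i i' where p: "p = (i, i')" by (cases p)
    let ?S = "fold f xs id_mat"
    let ?M = "mat_mult I ?S X"
    have IH: "unitriangular I rI ?S" "cleared (set xs) J rJ ?M"
      using snoc.IH[of "p # ys"] snoc.prems by auto
    have "p \<in> set pairs" using snoc.prems by simp
    then have i: "i \<in> I" "i' \<in> I" "i \<noteq> i'" "(i, i') \<in> rI" using set_pairs p by auto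
    have sub: "set xs \<subseteq> set pairs" using snoc.prems by auto
    have before: "(k, i) \<in> rI" if "(k, k') \<in> set xs" for k k'
      using sorted_pairs that unfolding snoc.prems p by (auto simp: sorted_wrt_append)
    have after: "(i, k) \<in> rI" if "(k, k') \<in> set ys" for k k'
      using sorted_pairs that unfolding snoc.prems p by (auto simp: sorted_wrt_append)
    have fold: "fold f (xs @ [p]) id_mat = mat_mult I (elimination_mat J rJ ?M i i') ?S"
      by (simp add: f_def p)
    have "cleared (insert (i, i') (set xs)) J rJ (mat_mult I (elimination_mat J rJ ?M i i') ?M)"
    proof (rule cleared_elimination[OF I(1) J i(1-3) IH(2)])
      show "set xs \<subseteq> I \<times> I" using sub set_pairs by auto
      show "k \<noteq> i'" if "(k, k') \<in> set xs" for k k'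
        using before[OF that] i linear_order_antisym[OF I(2)] by blast
      \<comment> \<open>If \<open>k\<close> differs from \<open>i\<close>, the pair
        \<open>(k, i)\<close> occurs in the list; its first component lies strictly before
        \<open>i\<close>, so it cannot stand at or after the current pair.\<close>
      show "k = i \<or> (k, i) \<in> set xs" if k: "(k, i') \<in> set xs" for k
      proof (rule disjCI)
        assume "(k, i) \<notin> set xs"
        moreover have "(k, i) \<in> set pairs" if "k \<noteq> i"
          using k sub set_pairs before[OF k] i that by auto
        ultimately show "k = i"
          using after before[OF k] linear_order_antisym[OF I(2)] unfolding snoc.prems p by auto
      qed
    qed
    then show ?case
      using unitriangular_elimination[OF I i IH(1)] unfolding fold mat_mult_assoc[OF I(1) I(1)] by (simp add: p)
  qed
  then have *: "unitriangular I rI (fold f pairs id_mat)"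
    "cleared (set pairs) J rJ (mat_mult I (fold f pairs id_mat) X)" by auto
  have red: "reduction_mat I rI J rJ X = fold f pairs id_mat"
    unfolding reduction_mat_def pairs_def ks_def f_def ..
  show ?t1 using * red by simp
  show ?t2 using * unfolding row_echelon_def row_reduced_def red cleared_def set_pairs by auto
qed

section \<open>Triangular and reduced matrices\<close>

lemma sum_nonzero_term:
  "sum f K \<noteq> 0 \<Longrightarrow> \<exists>k\<in>K. f k \<noteq> 0"
  by (metis sum.neutral)

text \<open>Ties are broken arbitrarily, so position yields only a weak inequality; the opposite
  strict one would put the pair in both orders and force \<open>k = l\<close>.\<close>

lemma ordered_by_mono:
  assumes "ordered_by K f r" "(k, l) \<in> r" "k \<in> K" "l \<in> K"
  shows "f k \<le> f l"
  using assms linear_order_antisym[of K r k l] unfolding ordered_by_def by (metis not_le order.refl)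

lemma reverse_ordered_by_antimono:
  assumes "reverse_ordered_by K f r" "(k, l) \<in> r" "k \<in> K" "l \<in> K"
  shows "f l \<le> f k"
  using assms linear_order_antisym[of K r k l] unfolding reverse_ordered_by_def by (metis not_le order.refl)

text \<open>Forward substitution. It is stated for the rows in an initial segment \<open>Q\<close>, because the
  rows of the matrices at hand are cut off at a time threshold.\<close>

lemma unitriangular_kernel:
  assumes K: "finite K" and r: "linear_order_on K r" and A: "unitriangular K r A"
    and Q: "\<And>k l. k \<in> K \<Longrightarrow> l \<in> K \<Longrightarrow> (l, k) \<in> r \<Longrightarrow> k \<in> Q \<Longrightarrow> l \<in> Q"
    and zero: "\<And>k. k \<in> K \<Longrightarrow> k \<in> Q \<Longrightarrow> (\<Sum>l\<in>K. A k l * y l) = 0"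
    and "k \<in> K" "k \<in> Q"
  shows "y k = 0"
proof -
  have "k \<in> Q \<longrightarrow> y k = 0"
    using K r \<open>k \<in> K\<close>
  proof (induction k rule: linear_order_induct)
    case (less k)
    show ?case
    proof
      assume k: "k \<in> Q"
      have "A k l * y l = 0" if "l \<in> K" "l \<noteq> k" for l
      proof (cases "A k l = 0")
        case False
        then have "(l, k) \<in> r" using A less.hyps that unfolding unitriangular_def by blast
        then show ?thesis using less.IH Q less.hyps that k by simp
      qed simp
      then have "(\<Sum>l\<in>K - {k}. A k l * y l) = 0"
        by (intro sum.neutral) blast
      then have "(\<Sum>l\<in>K. A k l * y l) = A k k * y k"
        using K less.hyps by (simp add: sum.remove[of K k])
      then show "y k = 0"
        using zero[OF less.hyps k] A less.hyps unfolding unitriangular_def by simp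
    qed
  qed
  then show ?thesis using \<open>k \<in> Q\<close> by simp
qed

lemma unitriangular_transpose:
  "unitriangular K r A \<Longrightarrow> unitriangular K (r\<inverse>) (\<lambda>k l. A l k)"
  unfolding unitriangular_def by auto

text \<open>Forward substitution for the transpose; reversing the order makes \<open>Q\<close> a
  final segment. It replaces invertibility of \<open>A\<close> when a row vector is multiplied by
  it.\<close>

lemma unitriangular_left_kernel:
  assumes K: "finite K" and r: "linear_order_on K r" and A: "unitriangular K r A"
    and Q: "\<And>k l. k \<in> K \<Longrightarrow> l \<in> K \<Longrightarrow> (k, l) \<in> r \<Longrightarrow> k \<in> Q \<Longrightarrow> l \<in> Q"
    and zero: "\<And>k. k \<in> K \<Longrightarrow> k \<in> Q \<Longrightarrow> (\<Sum>l\<in>K. y l * A l k) = 0"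
    and "k \<in> K" "k \<in> Q"
  shows "y k = 0"
  using unitriangular_kernel[OF K _ unitriangular_transpose[OF A], of Q y k] assms
  by (simp add: mult.commute)

text \<open>By induction along \<open>rI\<close>, the unit vector at row \<open>k\<close> is a
  combination of columns in \<open>L\<close> whenever the pivot of \<open>k\<close> is in
  \<open>L\<close>. The pivot column is zero after row \<open>k\<close>. An earlier row with a
  nonzero entry in it has its pivot no later than this column, hence in the initial segment
  \<open>L\<close>, so the unit vector of that row is already available for subtraction.\<close>

lemma row_echelon_span:
  fixes M :: "'i \<Rightarrow> 'j \<Rightarrow> 'f::field"
  assumes I: "finite I" "linear_order_on I rI" and J: "finite J" "linear_order_on J rJ"
    and M: "row_echelon I rI J rJ M"
    and L: "\<And>j k. j \<in> J \<Longrightarrow> k \<in> J \<Longrightarrow> (j, k) \<in> rJ \<Longrightarrow> k \<in> L \<Longrightarrow> j \<in> L"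
    and y: "\<And>i. i \<in> I \<Longrightarrow> y i \<noteq> 0 \<Longrightarrow> has_pivot J M i \<and> pivot J rJ M i \<in> L"
  obtains c where "\<And>j. c j \<noteq> 0 \<Longrightarrow> j \<in> J \<inter> L" "\<And>i. i \<in> I \<Longrightarrow> (\<Sum>j\<in>J. M i j * c j) = y i"
proof -
  define span where "span = (\<lambda>y. \<exists>c. (\<forall>j. c j \<noteq> 0 \<longrightarrow> j \<in> J \<inter> L) \<and> (\<forall>i\<in>I. (\<Sum>j\<in>J. M i j * c j) = y i))"
  \<comment> \<open>Membership is asked only where the coefficient is nonzero, because unit vectors
    of rows without a pivot in \<open>L\<close> need not lie in the span.\<close>
  have span_sum: "span (\<lambda>i. \<Sum>k\<in>K. x k * v k i)"
    if v: "\<And>k. k \<in> K \<Longrightarrow> x k \<noteq> 0 \<Longrightarrow> span (v k)" for K :: "'i set" and x v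
  proof -
    have "\<exists>c. x k \<noteq> 0 \<longrightarrow> (\<forall>j. c j \<noteq> 0 \<longrightarrow> j \<in> J \<inter> L) \<and> (\<forall>i\<in>I. (\<Sum>j\<in>J. M i j * c j) = v k i)"
      if "k \<in> K" for k
      using v[OF that] unfolding span_def by blast
    then obtain c where c: "\<And>k. k \<in> K \<Longrightarrow> x k \<noteq> 0 \<Longrightarrow>
        (\<forall>j. c k j \<noteq> 0 \<longrightarrow> j \<in> J \<inter> L) \<and> (\<forall>i\<in>I. (\<Sum>j\<in>J. M i j * c k j) = v k i)"
      by metis
    show ?thesis
      unfolding span_def
    proof (intro exI[of _ "\<lambda>j. \<Sum>k\<in>K. x k * c k j"] conjI allI impI ballI)
      fix j assume "(\<Sum>k\<in>K. x k * c k j) \<noteq> 0"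
      then obtain k where "k \<in> K" "x k * c k j \<noteq> 0" using sum_nonzero_term by blast
      then show "j \<in> J \<inter> L" using c[of k] by auto
    next
      fix i assume i: "i \<in> I"
      have "(\<Sum>j\<in>J. M i j * (\<Sum>k\<in>K. x k * c k j)) = (\<Sum>k\<in>K. x k * (\<Sum>j\<in>J. M i j * c k j))"
        unfolding sum_distrib_left by (subst sum.swap) (simp add: mult.left_commute)
      also have "\<dots> = (\<Sum>k\<in>K. x k * v k i)"
        using c i by (intro sum.cong refl) (metis mult_zero_left)
      finally show "(\<Sum>j\<in>J. M i j * (\<Sum>k\<in>K. x k * c k j)) = (\<Sum>k\<in>K. x k * v k i)" .
    qed
  qed
  have unit: "has_pivot J M k \<longrightarrow> pivot J rJ M k \<in> L \<longrightarrow> span (\<lambda>i. if i = k then 1 else 0)"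
    if "k \<in> I" for k
    using I that
  proof (induction k rule: linear_order_induct)
    case (less k)
    show ?case
    proof (intro impI)
      define p where "p = pivot J rJ M k"
      assume k: "has_pivot J M k" "pivot J rJ M k \<in> L"
      have p: "p \<in> J" "p \<in> L" "M k p \<noteq> 0"
        using k(2) pivot_in[OF J k(1)] pivot_nonzero[OF J k(1)] by (simp_all add: p_def)
      have IH: "span (\<lambda>i. if i = l then 1 else 0)" if l: "l \<in> I" "l \<noteq> k" "M l p \<noteq> 0" for l
      proof -
        have "(l, k) \<in> rI"
          using M l k less.hyps linear_order_total[OF I(2)] unfolding row_echelon_def p_def by metis
        moreover have l': "has_pivot J M l" using l p unfolding has_pivot_def by auto
        moreover have "pivot J rJ M l \<in> L"
          by (rule L[OF pivot_in[OF J l'] p(1) pivot_least[OF J l' p(1) l(3)] p(2)])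
        ultimately show ?thesis using less.IH l by blast
      qed
      have "span (\<lambda>i. \<Sum>l\<in>I-{k}. M l p * (if i = l then 1 else 0))"
        using IH by (intro span_sum) auto
      then obtain c where c: "\<And>j. c j \<noteq> 0 \<Longrightarrow> j \<in> J \<inter> L"
        "\<And>i. i \<in> I \<Longrightarrow> (\<Sum>j\<in>J. M i j * c j) = (\<Sum>l\<in>I-{k}. M l p * (if i = l then 1 else 0))"
        unfolding span_def by blast
      have c': "(\<Sum>j\<in>J. M i j * c j) = (if i = k then 0 else M i p)" if "i \<in> I" for i
        unfolding c(2)[OF that] using I(1) that by (simp add: if_distrib[of "(*) _"] cong: if_cong)
      \<comment> \<open>The pivot column minus its part in the other rows, scaled so that the entry
        in row \<open>k\<close> becomes 1.\<close>
      let ?c = "\<lambda>j. ((if j = p then 1 else 0) - c j) / M k p"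
      show "span (\<lambda>i. if i = k then 1 else 0)"
        unfolding span_def
      proof (intro exI[of _ ?c] conjI allI impI ballI)
        fix j assume "?c j \<noteq> 0"
        then show "j \<in> J \<inter> L" using c(1) p by (cases "j = p") auto
      next
        fix i assume i: "i \<in> I"
        have "(\<Sum>j\<in>J. M i j * ?c j) = ((\<Sum>j\<in>J. if j = p then M i j else 0) - (\<Sum>j\<in>J. M i j * c j)) / M k p"
          unfolding sum_subtractf[symmetric] sum_divide_distrib
          by (intro sum.cong) (auto simp: algebra_simps diff_divide_distrib)
        then show "(\<Sum>j\<in>J. M i j * ?c j) = (if i = k then 1 else 0)"
          using c'[OF i] p J(1) by simp
      qed
    qed
  qed
  have "span (\<lambda>i. \<Sum>k\<in>I. y k * (if i = k then 1 else 0))"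
    using unit y by (intro span_sum) auto
  then obtain c where c: "\<And>j. c j \<noteq> 0 \<Longrightarrow> j \<in> J \<inter> L"
    "\<And>i. i \<in> I \<Longrightarrow> (\<Sum>j\<in>J. M i j * c j) = (\<Sum>k\<in>I. y k * (if i = k then 1 else 0))"
    unfolding span_def by blast
  moreover have "(\<Sum>k\<in>I. y k * (if i = k then 1 else 0)) = y i" if "i \<in> I" for i
    using I(1) that by (simp add: if_distrib[of "(*) _"] cong: if_cong)
  ultimately show thesis
    by (intro that[of c]) simp_all
qed

section \<open>Reduced presentations\<close>

text \<open>The linear algebra without modules: births and deaths lie in an arbitrary linear order,
  and a time is a threshold \<open>x\<close> in it at which a bar is alive if its birth is at most
  \<open>x\<close> and its death is greater.\<close>

locale reduced_presentation =
  fixes J :: "'j set" and I :: "'i set" and b' d' :: "'j \<Rightarrow> 'c::linorder" and b d :: "'i \<Rightarrow> 'c"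
    and X :: "'i \<Rightarrow> 'j \<Rightarrow> 'f::field" and rJ rI rows cols
    and S SX p' P d'' T S' q'
  assumes J: "finite J" and I: "finite I"
    and bars: "i \<in> I \<Longrightarrow> b i \<le> d i"
    and rJ: "ordered_by J b' rJ" and rI: "reverse_ordered_by I d rI"
    and X_birth: "i \<in> I \<Longrightarrow> j \<in> J \<Longrightarrow> X i j \<noteq> 0 \<Longrightarrow> b i \<le> b' j"
    and X_death: "i \<in> I \<Longrightarrow> j \<in> J \<Longrightarrow> X i j \<noteq> 0 \<Longrightarrow> d i \<le> d' j"
    and S_def: "S = reduction_mat I rI J rJ X"
    and SX_def: "SX = row_reduced I rI J rJ X"
    and p'_def: "p' = pivot J rJ SX"
    and P_def: "P = {i\<in>I. has_pivot J SX i \<and> b' (p' i) < d i}"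
    and d''_def: "d'' = (\<lambda>i. if i \<in> P then b' (p' i) else d i)"
    and rows: "reverse_ordered_by I d'' rows" and cols: "ordered_by I b cols"
    and T_def: "T = reduction_mat I rows I cols S"
    and S'_def: "S' = row_reduced I rows I cols S"
    and q'_def: "q' = pivot I cols S'"
begin

section \<open>Triangularity and support of the matrices\<close>

lemma lin_rJ: "linear_order_on J rJ" and lin_rI: "linear_order_on I rI"
  and lin_rows: "linear_order_on I rows" and lin_cols: "linear_order_on I cols"
  using rJ rI rows cols unfolding ordered_by_def reverse_ordered_by_def by auto

lemma unitriangular_S: "unitriangular I rI S"
  unfolding S_def by (rule unitriangular_reduction_mat[OF I lin_rI J lin_rJ])

lemma unitriangular_T: "unitriangular I rows T"
  unfolding T_def by (rule unitriangular_reduction_mat[OF I lin_rows I lin_cols])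

lemma row_echelon_SX: "row_echelon I rI J rJ SX"
  unfolding SX_def by (rule row_echelon_row_reduced[OF I lin_rI J lin_rJ])

lemma row_echelon_S': "row_echelon I rows I cols S'"
  unfolding S'_def by (rule row_echelon_row_reduced[OF I lin_rows I lin_cols])

lemma SX_eq: "SX = mat_mult I S X" and S'_eq: "S' = mat_mult I T S"
  by (simp_all add: SX_def S_def S'_def T_def row_reduced_def)

lemma death_le: "i \<in> I \<Longrightarrow> d'' i \<le> d i"
  by (auto simp: d''_def P_def)

lemma S_death: "i \<in> I \<Longrightarrow> k \<in> I \<Longrightarrow> S i k \<noteq> 0 \<Longrightarrow> d i \<le> d k"
  using unitriangular_S reverse_ordered_by_antimono[OF rI] unfolding unitriangular_def by blast

lemma T_death: "i \<in> I \<Longrightarrow> k \<in> I \<Longrightarrow> T i k \<noteq> 0 \<Longrightarrow> d'' i \<le> d'' k"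
  using unitriangular_T reverse_ordered_by_antimono[OF rows] unfolding unitriangular_def by blast

text \<open>Along a nonzero product \<open>T i m * S m k\<close> one has
  \<open>d'' i \<le> d'' m \<le> d m \<le> d k\<close>.\<close>

lemma S'_death:
  assumes "i \<in> I" "k \<in> I" "S' i k \<noteq> 0"
  shows "d'' i \<le> d k"
proof -
  obtain m where "m \<in> I" "T i m \<noteq> 0" "S m k \<noteq> 0"
    using sum_nonzero_term assms(3) unfolding S'_eq mat_mult_def by fastforce
  then show ?thesis
    using T_death[OF assms(1)] death_le S_death[OF _ assms(2)] by (meson order.trans)
qed

text \<open>In a row with a pivot, \<open>d'' i\<close> is the minimum of \<open>d i\<close> and
  \<open>b' (p' i)\<close>; columns are sorted by birth, so no nonzero entry of the row is born
  before its pivot.\<close>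

lemma SX_death:
  assumes "i \<in> I" "j \<in> J" "SX i j \<noteq> 0"
  shows "d'' i \<le> b' j"
proof -
  have piv: "has_pivot J SX i" using assms unfolding has_pivot_def by blast
  have "b' (p' i) \<le> b' j"
    unfolding p'_def
    using pivot_least[OF J lin_rJ piv assms(2,3)] pivot_in[OF J lin_rJ piv] assms(2)
    by (rule ordered_by_mono[OF rJ])
  then show ?thesis using piv assms(1) by (auto simp: d''_def P_def)
qed

text \<open>\<open>S' X = T (S X)\<close>, and row \<open>i\<close> of \<open>T\<close> combines
  only rows \<open>m\<close> with \<open>d'' i \<le> d'' m\<close>.\<close>

lemma S'X_death:
  assumes "i \<in> I" "j \<in> J" "mat_mult I S' X i j \<noteq> 0"
  shows "d'' i \<le> b' j"
proof -
  obtain m where "m \<in> I" "T i m \<noteq> 0" "SX m j \<noteq> 0"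
    using sum_nonzero_term assms(3) unfolding S'_eq mat_mult_assoc[OF I I] SX_eq[symmetric]
    by (subst (asm) mat_mult_def) fastforce
  then show ?thesis
    using T_death[OF assms(1)] SX_death[OF _ assms(2)] by (meson order.trans)
qed

text \<open>A zero row of \<open>T S\<close> would put row \<open>i\<close> of \<open>T\<close> into
  the left kernel of \<open>S\<close>, contradicting \<open>T i i = 1\<close>.\<close>

lemma has_pivot_S':
  assumes "i \<in> I"
  shows "has_pivot I S' i"
proof (rule ccontr)
  assume "\<not> ?thesis"
  then have "(\<Sum>l\<in>I. T i l * S l k) = 0" if "k \<in> I" for k
    using that unfolding has_pivot_def S'_eq mat_mult_def by blast
  then have "T i i = 0"
    using unitriangular_left_kernel[OF I lin_rI unitriangular_S, of UNIV "T i" i] assms by simp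
  then show False using unitriangular_T assms unfolding unitriangular_def by simp
qed

lemma S'_birth:
  assumes "i \<in> I" "k \<in> I" "S' i k \<noteq> 0"
  shows "b (q' i) \<le> b k"
  unfolding q'_def using pivot_least[OF I lin_cols has_pivot_S' assms(2,3)] assms
    pivot_in[OF I lin_cols has_pivot_S'] by (intro ordered_by_mono[OF cols]) auto

text \<open>\<open>rJ\<close> sorts by birth, so the columns born by \<open>x\<close> form an
  initial segment and \<open>row_echelon_span\<close> applies to \<open>SX\<close>.\<close>

lemma column_span:
  assumes "\<And>i. i \<in> I \<Longrightarrow> y i \<noteq> 0 \<Longrightarrow> i \<in> P \<and> b' (p' i) \<le> x"
  obtains c where "\<And>j. c j \<noteq> 0 \<Longrightarrow> j \<in> J \<and> b' j \<le> x"
    "\<And>i. i \<in> I \<Longrightarrow> (\<Sum>j\<in>J. SX i j * c j) = y i"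
proof -
  have "(\<And>j k. j \<in> J \<Longrightarrow> k \<in> J \<Longrightarrow> (j, k) \<in> rJ \<Longrightarrow> k \<in> {j. b' j \<le> x} \<Longrightarrow> j \<in> {j. b' j \<le> x})"
    using ordered_by_mono[OF rJ] by (auto intro: order.trans)
  moreover have "\<And>i. i \<in> I \<Longrightarrow> y i \<noteq> 0 \<Longrightarrow> has_pivot J SX i \<and> pivot J rJ SX i \<in> {j. b' j \<le> x}"
    using assms by (auto simp: P_def p'_def)
  ultimately obtain c where "\<And>j. c j \<noteq> 0 \<Longrightarrow> j \<in> J \<inter> {j. b' j \<le> x}"
    "\<And>i. i \<in> I \<Longrightarrow> (\<Sum>j\<in>J. SX i j * c j) = y i"
    using row_echelon_span[OF I lin_rI J lin_rJ row_echelon_SX, of "{j. b' j \<le> x}" y] by blast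
  then show thesis using that by blast
qed

text \<open>The rows with \<open>x < d i\<close> form an initial segment of \<open>rI\<close>, which
  sorts deaths downwards, so forward substitution can be confined to them. The next lemma does the
  same for \<open>T\<close> and \<open>d''\<close>.\<close>

lemma S_solution:
  assumes "\<And>i. i \<in> I \<Longrightarrow> x < d i \<Longrightarrow> (\<Sum>k\<in>I. S i k * y k) = 0" and "i \<in> I" "x < d i"
  shows "y i = 0"
  using unitriangular_kernel[OF I lin_rI unitriangular_S, of "{i. x < d i}" y i] assms
    reverse_ordered_by_antimono[OF rI] by (auto intro: order.strict_trans2)

lemma T_solution:
  assumes "\<And>i. i \<in> I \<Longrightarrow> x < d'' i \<Longrightarrow> (\<Sum>k\<in>I. T i k * y k) = 0" and "i \<in> I" "x < d'' i"
  shows "y i = 0"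
  using unitriangular_kernel[OF I lin_rows unitriangular_T, of "{i. x < d'' i}" y i] assms
    reverse_ordered_by_antimono[OF rows] by (auto intro: order.strict_trans2)

text \<open>In both cases some \<open>k\<close> has \<open>S' i k \<noteq> 0\<close> and
  \<open>b k \<le> d'' i\<close>, and \<open>S'_birth\<close> concludes. For \<open>i\<close> in
  \<open>P\<close> it comes from a column of \<open>X\<close> born by \<open>d'' i\<close>,
  otherwise from a bar \<open>k\<close> of \<open>V\<close> that dies by \<open>d i\<close>.\<close>

lemma birth_le_death:
  assumes i: "i \<in> I"
  shows "b (q' i) \<le> d'' i"
proof (cases "i \<in> P")
  case True
  \<comment> \<open>The unit vector at \<open>i\<close> is written as \<open>SX c\<close>; then
    \<open>S' X c = T (SX c)\<close> has the entry \<open>T i i = 1\<close> in row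
    \<open>i\<close>.\<close>
  obtain c where c: "\<And>j. c j \<noteq> 0 \<Longrightarrow> j \<in> J \<and> b' j \<le> b' (p' i)"
    and ci: "\<And>l. l \<in> I \<Longrightarrow> (\<Sum>j\<in>J. SX l j * c j) = (if l = i then 1 else 0)"
    by (rule column_span[of "\<lambda>l. if l = i then 1 else 0" "b' (p' i)"]) (use True in \<open>auto split: if_splits\<close>)
  have "(\<Sum>k\<in>I. S' i k * (\<Sum>j\<in>J. X k j * c j)) = (\<Sum>j\<in>J. mat_mult I S' X i j * c j)"
    unfolding mat_mult_def sum_distrib_left sum_distrib_right by (subst sum.swap) (simp add: mult.assoc)
  also have "\<dots> = (\<Sum>l\<in>I. T i l * (\<Sum>j\<in>J. SX l j * c j))"
    unfolding S'_eq mat_mult_assoc[OF I I] SX_eq[symmetric]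
    unfolding mat_mult_def sum_distrib_left sum_distrib_right by (subst sum.swap) (simp add: mult.assoc)
  also have "\<dots> = (\<Sum>l\<in>I. if l = i then T i i else 0)"
    using ci by (intro sum.cong) auto
  also have "\<dots> = 1"
    using i I unitriangular_T unfolding unitriangular_def by simp
  finally have "(\<Sum>k\<in>I. S' i k * (\<Sum>j\<in>J. X k j * c j)) \<noteq> 0" by simp
  then obtain k where k: "k \<in> I" "S' i k * (\<Sum>j\<in>J. X k j * c j) \<noteq> 0"
    using sum_nonzero_term by blast
  then obtain j where j: "j \<in> J" "X k j \<noteq> 0" "c j \<noteq> 0"
    using sum_nonzero_term by fastforce
  show ?thesis
    using S'_birth[OF i k(1)] k(2) X_birth[OF k(1) j(1,2)] c[OF j(3)] True
    by (auto simp: d''_def)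
next
  case False
  \<comment> \<open>Otherwise row \<open>i\<close> of \<open>T S\<close> vanishes on the
    \<open>k\<close> with \<open>d k \<le> d i\<close>, a final segment of \<open>rI\<close>
    containing \<open>i\<close>, and substitution gives \<open>T i i = 0\<close>.\<close>
  have "\<exists>k\<in>I. d k \<le> d i \<and> S' i k \<noteq> 0"
  proof (rule ccontr)
    assume "\<not> ?thesis"
    then have "(\<Sum>l\<in>I. T i l * S l k) = 0" if "k \<in> I" "k \<in> {k. d k \<le> d i}" for k
      using that unfolding S'_eq mat_mult_def by blast
    then have "T i i = 0"
      using unitriangular_left_kernel[OF I lin_rI unitriangular_S, of "{k. d k \<le> d i}" "T i" i] i
        reverse_ordered_by_antimono[OF rI] by (auto intro: order.trans)
    then show False using unitriangular_T i unfolding unitriangular_def by simp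
  qed
  then obtain k where "k \<in> I" "d k \<le> d i" "S' i k \<noteq> 0" by blast
  then show ?thesis
    using S'_birth[OF i, of k] bars[of k] False by (auto simp: d''_def)
qed

text \<open>Undoing \<open>T\<close> shows that \<open>y = S v\<close> vanishes on the rows with
  \<open>x < d''\<close>. The other rows with \<open>x < d\<close> have nontrivial pivots in columns
  born by \<open>x\<close>, so on \<open>x < d\<close> the vector \<open>y\<close> equals some
  \<open>SX c\<close>. Undoing \<open>S\<close> gives \<open>v = X c\<close> there.\<close>

lemma kernel_in_image:
  assumes v: "\<And>k. k \<in> I \<Longrightarrow> v k \<noteq> 0 \<Longrightarrow> b k \<le> x"
    and zero: "\<And>i. i \<in> I \<Longrightarrow> b (q' i) \<le> x \<Longrightarrow> x < d'' i \<Longrightarrow> (\<Sum>k\<in>I. S' i k * v k) = 0"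
  obtains c where "\<And>j. c j \<noteq> 0 \<Longrightarrow> j \<in> J \<and> b' j \<le> x \<and> x < d' j"
    "\<And>i. i \<in> I \<Longrightarrow> x < d i \<Longrightarrow> v i = (\<Sum>j\<in>J. X i j * c j)"
proof -
  define y where "y i = (\<Sum>k\<in>I. S i k * v k)" for i
  have T_y: "(\<Sum>k\<in>I. T i k * y k) = (\<Sum>k\<in>I. S' i k * v k)" for i
    unfolding y_def S'_eq mat_mult_def sum_distrib_left sum_distrib_right
    by (subst sum.swap) (simp add: mult.assoc)
  have y_zero: "y i = 0" if "i \<in> I" "x < d'' i" for i
  proof (rule T_solution[OF _ that])
    fix i assume i: "i \<in> I" "x < d'' i"
    show "(\<Sum>k\<in>I. T i k * y k) = 0"
      unfolding T_y
    proof (cases "b (q' i) \<le> x")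
      case True
      then show "(\<Sum>k\<in>I. S' i k * v k) = 0" using zero i by blast
    next
      case False
      \<comment> \<open>Row \<open>i\<close> is not yet born at \<open>x\<close>: its nonzero
        entries sit in columns born after \<open>x\<close>, where \<open>v\<close> vanishes.\<close>
      then have "S' i k * v k = 0" if "k \<in> I" for k
        using S'_birth[OF i(1) that] v[OF that] by (cases "v k = 0"; cases "S' i k = 0") (auto dest: order.trans)
      then show "(\<Sum>k\<in>I. S' i k * v k) = 0" by simp
    qed
  qed
  \<comment> \<open>If \<open>x < d i\<close> and \<open>y i \<noteq> 0\<close>, then
    \<open>d'' i \<le> x < d i\<close>, so \<open>d'' i\<close> is the birth of a nontrivial pivot
    column. Rows dead at \<open>x\<close> are set to 0, since the conclusion leaves them
    free.\<close>
  obtain c where c: "\<And>j. c j \<noteq> 0 \<Longrightarrow> j \<in> J \<and> b' j \<le> x"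
    and SXc: "\<And>i. i \<in> I \<Longrightarrow> (\<Sum>j\<in>J. SX i j * c j) = (if x < d i then y i else 0)"
  proof (rule column_span[of "\<lambda>i. if x < d i then y i else 0" x])
    fix i assume "i \<in> I" "(if x < d i then y i else 0) \<noteq> 0"
    then show "i \<in> P \<and> b' (p' i) \<le> x"
      using y_zero[of i] by (cases "i \<in> P") (auto simp: d''_def simp flip: not_less split: if_splits)
  qed (rule that)
  have eq: "v i = (\<Sum>j\<in>J. X i j * c j)" if "i \<in> I" "x < d i" for i
  proof -
    have "v i - (\<Sum>j\<in>J. X i j * c j) = 0"
    proof (rule S_solution[OF _ that])
      fix i assume i: "i \<in> I" "x < d i"
      have "(\<Sum>k\<in>I. S i k * (\<Sum>j\<in>J. X k j * c j)) = (\<Sum>j\<in>J. SX i j * c j)"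
        unfolding SX_eq mat_mult_def sum_distrib_left sum_distrib_right
        by (subst sum.swap) (simp add: mult.assoc)
      then show "(\<Sum>k\<in>I. S i k * (v k - (\<Sum>j\<in>J. X k j * c j))) = 0"
        using SXc i by (simp add: y_def right_diff_distrib sum_subtractf)
    qed
    then show ?thesis by simp
  qed
  \<comment> \<open>Columns already dead at \<open>x\<close> are dropped; by \<open>X_death\<close>
    they have only zeros in rows with \<open>x < d i\<close>.\<close>
  show thesis
  proof (rule that[of "\<lambda>j. if x < d' j then c j else 0"])
    show "(if x < d' j then c j else 0) \<noteq> 0 \<Longrightarrow> j \<in> J \<and> b' j \<le> x \<and> x < d' j" for j
      using c by (auto split: if_splits)
    show "v i = (\<Sum>j\<in>J. X i j * (if x < d' j then c j else 0))" if i: "i \<in> I" "x < d i" for i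
      unfolding eq[OF i] using X_death[OF i(1)] i(2)
      by (intro sum.cong refl) (auto dest: order.strict_trans2)
  qed
qed

text \<open>Row \<open>i\<close> of \<open>S'\<close> sees only rows that die after
  \<open>x\<close>, where \<open>v\<close> equals \<open>X c\<close>. A nonzero entry of
  \<open>S' X\<close> in row \<open>i\<close> lies in a column born at \<open>d'' i\<close> or
  later, hence after \<open>x\<close>, where \<open>c\<close> vanishes.\<close>

lemma image_in_kernel:
  assumes v: "\<And>k. k \<in> I \<Longrightarrow> v k \<noteq> 0 \<Longrightarrow> x < d k"
    and c: "\<And>j. j \<in> J \<Longrightarrow> c j \<noteq> 0 \<Longrightarrow> b' j \<le> x"
    and eq: "\<And>i. i \<in> I \<Longrightarrow> x < d i \<Longrightarrow> v i = (\<Sum>j\<in>J. X i j * c j)"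
    and i: "i \<in> I" "x < d'' i"
  shows "(\<Sum>k\<in>I. S' i k * v k) = 0"
proof -
  have "S' i k * v k = S' i k * (\<Sum>j\<in>J. X k j * c j)" if "k \<in> I" for k
    using S'_death[OF i(1) that] i(2) eq[OF that] by (cases "S' i k = 0") auto
  then have "(\<Sum>k\<in>I. S' i k * v k) = (\<Sum>k\<in>I. S' i k * (\<Sum>j\<in>J. X k j * c j))"
    by (rule sum.cong[OF refl])
  also have "\<dots> = (\<Sum>j\<in>J. mat_mult I S' X i j * c j)"
    unfolding mat_mult_def sum_distrib_left sum_distrib_right by (subst sum.swap) (simp add: mult.assoc)
  also have "mat_mult I S' X i j * c j = 0" if "j \<in> J" for j
    using S'X_death[OF i(1) that] c[OF that] i(2)
    by (cases "c j = 0"; cases "mat_mult I S' X i j = 0") (auto dest: order.trans)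
  then have "(\<Sum>j\<in>J. mat_mult I S' X i j * c j) = 0"
    by simp
  finally show ?thesis .
qed

lemma S'_restrict:
  assumes "i \<in> I" "x < d'' i" "\<And>k. k \<in> I \<Longrightarrow> x < d k \<Longrightarrow> v k = w k"
  shows "(\<Sum>k\<in>I. S' i k * v k) = (\<Sum>k\<in>I. S' i k * w k)"
proof (intro sum.cong refl)
  fix k assume "k \<in> I"
  then show "S' i k * v k = S' i k * w k"
    using S'_death[of i k] assms by (cases "S' i k = 0") (auto dest: order.strict_trans2)
qed

lemma S'_birth_zero:
  assumes "i \<in> I" "\<not> b (q' i) \<le> x" "\<And>k. k \<in> I \<Longrightarrow> v k \<noteq> 0 \<Longrightarrow> b k \<le> x"
  shows "(\<Sum>k\<in>I. S' i k * v k) = 0"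
proof (intro sum.neutral ballI)
  fix k assume "k \<in> I"
  then show "S' i k * v k = 0"
    using S'_birth[of i k] assms by (cases "v k = 0"; cases "S' i k = 0") (auto dest: order.trans)
qed

text \<open>\<open>row_echelon_span\<close> for \<open>S'\<close> and the columns born by
  \<open>x\<close> solves the system; removing the coordinates dead at \<open>x\<close> is harmless
  by \<open>S'_restrict\<close>.\<close>

lemma S'_surj:
  assumes w: "\<And>i. i \<in> I \<Longrightarrow> w i \<noteq> 0 \<Longrightarrow> b (q' i) \<le> x"
  obtains v where "\<And>k. v k \<noteq> 0 \<Longrightarrow> k \<in> I \<and> b k \<le> x \<and> x < d k"
    "\<And>i. i \<in> I \<Longrightarrow> x < d'' i \<Longrightarrow> (\<Sum>k\<in>I. S' i k * v k) = w i"
proof -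
  have "\<And>k l. k \<in> I \<Longrightarrow> l \<in> I \<Longrightarrow> (k, l) \<in> cols \<Longrightarrow> l \<in> {k. b k \<le> x} \<Longrightarrow> k \<in> {k. b k \<le> x}"
    using ordered_by_mono[OF cols] by (auto intro: order.trans)
  moreover have "\<And>i. i \<in> I \<Longrightarrow> w i \<noteq> 0 \<Longrightarrow> has_pivot I S' i \<and> pivot I cols S' i \<in> {k. b k \<le> x}"
    using w has_pivot_S' by (auto simp: q'_def)
  ultimately obtain v where v: "\<And>k. v k \<noteq> 0 \<Longrightarrow> k \<in> I \<inter> {k. b k \<le> x}"
    "\<And>i. i \<in> I \<Longrightarrow> (\<Sum>k\<in>I. S' i k * v k) = w i"
    using row_echelon_span[OF I lin_rows I lin_cols row_echelon_S', of "{k. b k \<le> x}" w] by blast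
  show thesis
  proof (rule that[of "\<lambda>k. if x < d k then v k else 0"])
    show "(if x < d k then v k else 0) \<noteq> 0 \<Longrightarrow> k \<in> I \<and> b k \<le> x \<and> x < d k" for k
      using v(1) by (auto split: if_splits)
    show "(\<Sum>k\<in>I. S' i k * (if x < d k then v k else 0)) = w i" if "i \<in> I" "x < d'' i" for i
      unfolding v(2)[OF that(1), symmetric] by (rule S'_restrict[OF that]) simp
  qed
qed

end

section \<open>Modules over a field\<close>

lemma vectorspace_iff_module:
  "vectorspace (class_ring :: 'f::field ring) M \<longleftrightarrow> module class_ring M"
  using class_field unfolding vectorspace_def by auto

text \<open>Additive inverses are given by scaling with \<open>- 1\<close>, which leaves only
  closure properties and identities.\<close>

lemma module_class_ringI:
  fixes M :: "('f::field, 'v) module"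
  assumes closed: "\<zero>\<^bsub>M\<^esub> \<in> carrier M"
      "\<And>v w. v \<in> carrier M \<Longrightarrow> w \<in> carrier M \<Longrightarrow> v \<oplus>\<^bsub>M\<^esub> w \<in> carrier M"
      "\<And>a v. v \<in> carrier M \<Longrightarrow> a \<odot>\<^bsub>M\<^esub> v \<in> carrier M"
    and add: "\<And>u v w. u \<in> carrier M \<Longrightarrow> v \<in> carrier M \<Longrightarrow> w \<in> carrier M \<Longrightarrow>
        u \<oplus>\<^bsub>M\<^esub> v \<oplus>\<^bsub>M\<^esub> w = u \<oplus>\<^bsub>M\<^esub> (v \<oplus>\<^bsub>M\<^esub> w)"
      "\<And>v w. v \<in> carrier M \<Longrightarrow> w \<in> carrier M \<Longrightarrow> v \<oplus>\<^bsub>M\<^esub> w = w \<oplus>\<^bsub>M\<^esub> v"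
      "\<And>v. v \<in> carrier M \<Longrightarrow> \<zero>\<^bsub>M\<^esub> \<oplus>\<^bsub>M\<^esub> v = v"
      "\<And>v. v \<in> carrier M \<Longrightarrow> (- 1) \<odot>\<^bsub>M\<^esub> v \<oplus>\<^bsub>M\<^esub> v = \<zero>\<^bsub>M\<^esub>"
    and smult: "\<And>a b v. v \<in> carrier M \<Longrightarrow> (a + b) \<odot>\<^bsub>M\<^esub> v = a \<odot>\<^bsub>M\<^esub> v \<oplus>\<^bsub>M\<^esub> b \<odot>\<^bsub>M\<^esub> v"
      "\<And>a v w. v \<in> carrier M \<Longrightarrow> w \<in> carrier M \<Longrightarrow> a \<odot>\<^bsub>M\<^esub> (v \<oplus>\<^bsub>M\<^esub> w) = a \<odot>\<^bsub>M\<^esub> v \<oplus>\<^bsub>M\<^esub> a \<odot>\<^bsub>M\<^esub> w"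
      "\<And>a b v. v \<in> carrier M \<Longrightarrow> (a * b) \<odot>\<^bsub>M\<^esub> v = a \<odot>\<^bsub>M\<^esub> (b \<odot>\<^bsub>M\<^esub> v)"
      "\<And>v. v \<in> carrier M \<Longrightarrow> 1 \<odot>\<^bsub>M\<^esub> v = v"
  shows "module class_ring M"
proof (rule moduleI)
  show "cring (class_ring :: 'f ring)"
    by (rule class_field[THEN field.axioms(1), THEN domain.axioms(1)])
  show "abelian_group M"
  proof (rule abelian_groupI)
    show "\<exists>w\<in>carrier M. w \<oplus>\<^bsub>M\<^esub> v = \<zero>\<^bsub>M\<^esub>" if "v \<in> carrier M" for v
      using closed(3)[OF that] add(4)[OF that] by blast
  qed (rule closed(1,2) add(1-3); assumption)+
qed (use closed smult in auto)

lemma module_class_ringD: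
  fixes M :: "('f::field, 'v) module"
  assumes "module class_ring M"
  shows "\<zero>\<^bsub>M\<^esub> \<in> carrier M"
    "\<And>v w. v \<in> carrier M \<Longrightarrow> w \<in> carrier M \<Longrightarrow> v \<oplus>\<^bsub>M\<^esub> w \<in> carrier M"
    "\<And>a v. v \<in> carrier M \<Longrightarrow> a \<odot>\<^bsub>M\<^esub> v \<in> carrier M"
    "\<And>u v w. u \<in> carrier M \<Longrightarrow> v \<in> carrier M \<Longrightarrow> w \<in> carrier M \<Longrightarrow>
        u \<oplus>\<^bsub>M\<^esub> v \<oplus>\<^bsub>M\<^esub> w = u \<oplus>\<^bsub>M\<^esub> (v \<oplus>\<^bsub>M\<^esub> w)"
    "\<And>v w. v \<in> carrier M \<Longrightarrow> w \<in> carrier M \<Longrightarrow> v \<oplus>\<^bsub>M\<^esub> w = w \<oplus>\<^bsub>M\<^esub> v"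
    "\<And>v. v \<in> carrier M \<Longrightarrow> \<zero>\<^bsub>M\<^esub> \<oplus>\<^bsub>M\<^esub> v = v"
    "\<And>v. v \<in> carrier M \<Longrightarrow> (- 1) \<odot>\<^bsub>M\<^esub> v \<oplus>\<^bsub>M\<^esub> v = \<zero>\<^bsub>M\<^esub>"
    "\<And>a b v. v \<in> carrier M \<Longrightarrow> (a + b) \<odot>\<^bsub>M\<^esub> v = a \<odot>\<^bsub>M\<^esub> v \<oplus>\<^bsub>M\<^esub> b \<odot>\<^bsub>M\<^esub> v"
    "\<And>a v w. v \<in> carrier M \<Longrightarrow> w \<in> carrier M \<Longrightarrow> a \<odot>\<^bsub>M\<^esub> (v \<oplus>\<^bsub>M\<^esub> w) = a \<odot>\<^bsub>M\<^esub> v \<oplus>\<^bsub>M\<^esub> a \<odot>\<^bsub>M\<^esub> w"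
    "\<And>a b v. v \<in> carrier M \<Longrightarrow> (a * b) \<odot>\<^bsub>M\<^esub> v = a \<odot>\<^bsub>M\<^esub> (b \<odot>\<^bsub>M\<^esub> v)"
    "\<And>v. v \<in> carrier M \<Longrightarrow> 1 \<odot>\<^bsub>M\<^esub> v = v"
proof -
  interpret M: Module.module class_ring M by fact
  show "\<zero>\<^bsub>M\<^esub> \<in> carrier M"
    "\<And>v w. v \<in> carrier M \<Longrightarrow> w \<in> carrier M \<Longrightarrow> v \<oplus>\<^bsub>M\<^esub> w \<in> carrier M"
    "\<And>a v. v \<in> carrier M \<Longrightarrow> a \<odot>\<^bsub>M\<^esub> v \<in> carrier M"
    "\<And>u v w. u \<in> carrier M \<Longrightarrow> v \<in> carrier M \<Longrightarrow> w \<in> carrier M \<Longrightarrow>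
        u \<oplus>\<^bsub>M\<^esub> v \<oplus>\<^bsub>M\<^esub> w = u \<oplus>\<^bsub>M\<^esub> (v \<oplus>\<^bsub>M\<^esub> w)"
    "\<And>v w. v \<in> carrier M \<Longrightarrow> w \<in> carrier M \<Longrightarrow> v \<oplus>\<^bsub>M\<^esub> w = w \<oplus>\<^bsub>M\<^esub> v"
    "\<And>v. v \<in> carrier M \<Longrightarrow> \<zero>\<^bsub>M\<^esub> \<oplus>\<^bsub>M\<^esub> v = v"
    "\<And>a v w. v \<in> carrier M \<Longrightarrow> w \<in> carrier M \<Longrightarrow> a \<odot>\<^bsub>M\<^esub> (v \<oplus>\<^bsub>M\<^esub> w) = a \<odot>\<^bsub>M\<^esub> v \<oplus>\<^bsub>M\<^esub> a \<odot>\<^bsub>M\<^esub> w"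
    by (auto simp: M.M.a_assoc M.M.a_comm M.M.a_lcomm M.smult_r_distr)
  show l_distr: "\<And>a b v. v \<in> carrier M \<Longrightarrow> (a + b) \<odot>\<^bsub>M\<^esub> v = a \<odot>\<^bsub>M\<^esub> v \<oplus>\<^bsub>M\<^esub> b \<odot>\<^bsub>M\<^esub> v"
    using M.smult_l_distr by simp
  show "\<And>a b v. v \<in> carrier M \<Longrightarrow> (a * b) \<odot>\<^bsub>M\<^esub> v = a \<odot>\<^bsub>M\<^esub> (b \<odot>\<^bsub>M\<^esub> v)"
    using M.smult_assoc1 by simp
  show one: "\<And>v. v \<in> carrier M \<Longrightarrow> 1 \<odot>\<^bsub>M\<^esub> v = v"
    using M.smult_one by simp
  have null: "\<And>v. v \<in> carrier M \<Longrightarrow> 0 \<odot>\<^bsub>M\<^esub> v = \<zero>\<^bsub>M\<^esub>"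
    using M.smult_l_null by simp
  show "(- 1) \<odot>\<^bsub>M\<^esub> v \<oplus>\<^bsub>M\<^esub> v = \<zero>\<^bsub>M\<^esub>" if "v \<in> carrier M" for v
    using l_distr[OF that, of "- 1" 1] one[OF that] null[OF that] by simp
qed

text \<open>Closure properties and identities pass along a surjection that respects the operations.
  This serves the cokernel, whose operations are known through representatives.\<close>

lemma module_surj_image:
  fixes M :: "('f::field, 'v) module" and N :: "('f, 'w) module"
  assumes M: "module class_ring M"
    and q: "q ` carrier M = carrier N" "\<zero>\<^bsub>N\<^esub> = q \<zero>\<^bsub>M\<^esub>"
      "\<And>v w. v \<in> carrier M \<Longrightarrow> w \<in> carrier M \<Longrightarrow> q v \<oplus>\<^bsub>N\<^esub> q w = q (v \<oplus>\<^bsub>M\<^esub> w)"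
      "\<And>a v. v \<in> carrier M \<Longrightarrow> a \<odot>\<^bsub>N\<^esub> q v = q (a \<odot>\<^bsub>M\<^esub> v)"
  shows "module class_ring N"
proof -
  note D = module_class_ringD[OF M]
  note eqs = q(2-4)
  show ?thesis
  proof (rule module_class_ringI; unfold q(1)[symmetric])
    show "v \<oplus>\<^bsub>N\<^esub> w = w \<oplus>\<^bsub>N\<^esub> v" if "v \<in> q ` carrier M" "w \<in> q ` carrier M" for v w
      using that by (auto simp: eqs) (metis D(5))
  qed (auto simp: eqs D(1-4,6-11))
qed

section \<open>Interval modules and cokernels\<close>

text \<open>Places times among the cuts. The time \<open>t\<close> itself goes into the upper part,
  so a bar contains \<open>t\<close> exactly when birth \<le> \<open>cut_below t\<close> < death;
  this cut is the threshold \<open>x\<close> of the matrix lemmas.\<close>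

definition cut_below :: "'r::linorder \<Rightarrow> 'r cut" where
  "cut_below t = Cut ({..<t}, {t..})"

lemma lower_cut_below: "lower (cut_below t) = {..<t}"
  unfolding lower_def cut_below_def by (subst Cut_inverse) auto

lemma le_cut_below_iff: "c \<le> cut_below t \<longleftrightarrow> t \<in> upper c"
  unfolding less_eq_cut_def lower_cut_below using cut_less[of _ c t] by (auto simp: upper_eq)

lemma in_interval_iff: "t \<in> interval a c \<longleftrightarrow> a \<le> cut_below t \<and> cut_below t < c"
  unfolding interval_def le_cut_below_iff not_le[symmetric] by (simp add: upper_eq)

lemma interval_convex:
  assumes "r \<in> interval a c" "t \<in> interval a c" "r \<le> s" "s \<le> t"
  shows "s \<in> interval a c"
proof -
  have "s \<in> upper a" using assms cut_less[of s a r] by (auto simp: interval_def upper_eq)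
  moreover have "s \<in> lower c" using assms cut_less[of t c s] leD by (auto simp: interval_def upper_eq)
  ultimately show ?thesis by (simp add: interval_def)
qed

lemma interval_sum_fibre:
  fixes a c :: "'k \<Rightarrow> 'r::linorder cut"
  assumes "finite K"
  shows "carrier (fibre (interval_sum K a c :: ('r, 'f::field, 'k \<Rightarrow> 'f) pmod) t) =
      {v \<in> extensional K. \<forall>k\<in>K. v k \<noteq> 0 \<longrightarrow> t \<in> interval (a k) (c k)}" (is ?carrier)
    and "\<zero>\<^bsub>fibre (interval_sum K a c :: ('r, 'f, 'k \<Rightarrow> 'f) pmod) t\<^esub> = (\<lambda>k\<in>K. 0)" (is ?zero)
    and "v \<oplus>\<^bsub>fibre (interval_sum K a c :: ('r, 'f, 'k \<Rightarrow> 'f) pmod) t\<^esub> w = (\<lambda>k\<in>K. v k + w k)" (is ?add)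
    and "x \<odot>\<^bsub>fibre (interval_sum K a c :: ('r, 'f, 'k \<Rightarrow> 'f) pmod) t\<^esub> v = (\<lambda>k\<in>K. x * v k)" (is ?smult)
    and "smap (interval_sum K a c :: ('r, 'f, 'k \<Rightarrow> 'f) pmod) s t v =
      (\<lambda>k\<in>K. if s \<in> interval (a k) (c k) \<and> t \<in> interval (a k) (c k) then v k else 0)" (is ?smap)
    and "pers_sum_incl K (\<lambda>k. interval_module (a k) (c k) :: ('r, 'f, 'f) pmod) t j x =
      (\<lambda>k\<in>K. if k = j then x else 0)" (is ?incl)
proof -
  show ?carrier
    using assms by (auto simp: pers_sum_def interval_module_def PiE_def Pi_def split: if_splits)
  show ?zero ?add ?smult ?smap ?incl
    by (simp_all add: pers_sum_def interval_module_def pers_sum_incl_def cong: if_cong)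
qed

text \<open>Functoriality is convexity of the bars: a bar containing \<open>r\<close> and
  \<open>t\<close> contains every time between them.\<close>

lemma persistence_module_interval_sum:
  fixes a c :: "'k \<Rightarrow> 'r::linorder cut"
  assumes "finite K"
  shows "persistence_module (interval_sum K a c :: ('r, 'f::field, 'k \<Rightarrow> 'f) pmod)"
    (is "persistence_module ?M")
  unfolding persistence_module_def vectorspace_iff_module
proof (intro conjI allI impI ballI)
  note F = interval_sum_fibre[OF assms, where 'f = 'f]
  fix t
  show "module class_ring (fibre ?M t)"
    by (rule module_class_ringI)
      (auto simp: F restrict_def extensional_def fun_eq_iff algebra_simps split: if_splits)
  show "smap ?M t t v = v" if "v \<in> carrier (fibre ?M t)" for v
    using that by (auto simp: F restrict_def extensional_def fun_eq_iff)
  fix s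
  show "smap ?M s t \<in> LinearCombinations.module_hom class_ring (fibre ?M s) (fibre ?M t)" if "s \<le> t"
    by (auto simp: LinearCombinations.module_hom_def F fun_eq_iff restrict_def extensional_def)
  fix r v
  assume "r \<le> s" "s \<le> t" "v \<in> carrier (fibre ?M r)"
  then show "smap ?M s t (smap ?M r s v) = smap ?M r t v"
    using interval_convex[of r _ _ t s] by (auto simp: F fun_eq_iff restrict_def)
qed

lemma module_homI:
  fixes M :: "('f::field, 'v) module"
  assumes "\<And>v. v \<in> carrier M \<Longrightarrow> f v \<in> carrier N"
    and "\<And>v w. v \<in> carrier M \<Longrightarrow> w \<in> carrier M \<Longrightarrow> f (v \<oplus>\<^bsub>M\<^esub> w) = f v \<oplus>\<^bsub>N\<^esub> f w"
    and "\<And>a v. v \<in> carrier M \<Longrightarrow> f (a \<odot>\<^bsub>M\<^esub> v) = a \<odot>\<^bsub>N\<^esub> f v"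
  shows "f \<in> LinearCombinations.module_hom class_ring M N"
  using assms by (auto simp: LinearCombinations.module_hom_def)

lemma pers_homD:
  assumes "pers_hom M N \<phi>"
  shows pers_hom_closed: "v \<in> carrier (fibre M t) \<Longrightarrow> \<phi> t v \<in> carrier (fibre N t)"
    and pers_hom_add: "v \<in> carrier (fibre M t) \<Longrightarrow> w \<in> carrier (fibre M t) \<Longrightarrow>
      \<phi> t (v \<oplus>\<^bsub>fibre M t\<^esub> w) = \<phi> t v \<oplus>\<^bsub>fibre N t\<^esub> \<phi> t w"
    and pers_hom_smult: "v \<in> carrier (fibre M t) \<Longrightarrow> \<phi> t (a \<odot>\<^bsub>fibre M t\<^esub> v) = a \<odot>\<^bsub>fibre N t\<^esub> \<phi> t v"
    and pers_hom_natural: "s \<le> t \<Longrightarrow> v \<in> carrier (fibre M s) \<Longrightarrow> \<phi> t (smap M s t v) = smap N s t (\<phi> s v)"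
proof -
  have "\<phi> t \<in> LinearCombinations.module_hom class_ring (fibre M t) (fibre N t)"
    using assms unfolding pers_hom_def by blast
  then show "v \<in> carrier (fibre M t) \<Longrightarrow> \<phi> t v \<in> carrier (fibre N t)"
    "v \<in> carrier (fibre M t) \<Longrightarrow> w \<in> carrier (fibre M t) \<Longrightarrow>
      \<phi> t (v \<oplus>\<^bsub>fibre M t\<^esub> w) = \<phi> t v \<oplus>\<^bsub>fibre N t\<^esub> \<phi> t w"
    "v \<in> carrier (fibre M t) \<Longrightarrow> \<phi> t (a \<odot>\<^bsub>fibre M t\<^esub> v) = a \<odot>\<^bsub>fibre N t\<^esub> \<phi> t v"
    by (auto simp: LinearCombinations.module_hom_def)
  show "s \<le> t \<Longrightarrow> v \<in> carrier (fibre M s) \<Longrightarrow> \<phi> t (smap M s t v) = smap N s t (\<phi> s v)"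
    using assms unfolding pers_hom_def by blast
qed

lemma persistence_moduleD:
  assumes "persistence_module M"
  shows pers_fibre_module: "module class_ring (fibre M t)"
    and pers_smap_hom: "s \<le> t \<Longrightarrow> smap M s t \<in> LinearCombinations.module_hom class_ring (fibre M s) (fibre M t)"
    and pers_smap_id: "v \<in> carrier (fibre M t) \<Longrightarrow> smap M t t v = v"
    and pers_smap_comp: "r \<le> s \<Longrightarrow> s \<le> t \<Longrightarrow> v \<in> carrier (fibre M r) \<Longrightarrow>
      smap M s t (smap M r s v) = smap M r t v"
  using assms by (simp_all add: persistence_module_def vectorspace_iff_module)

lemma pers_smap:
  assumes "persistence_module M" "s \<le> t" "v \<in> carrier (fibre M s)"
  shows pers_smap_closed: "smap M s t v \<in> carrier (fibre M t)"
    and pers_smap_add: "w \<in> carrier (fibre M s) \<Longrightarrow>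
      smap M s t (v \<oplus>\<^bsub>fibre M s\<^esub> w) = smap M s t v \<oplus>\<^bsub>fibre M t\<^esub> smap M s t w"
    and pers_smap_smult: "smap M s t (a \<odot>\<^bsub>fibre M s\<^esub> v) = a \<odot>\<^bsub>fibre M t\<^esub> smap M s t v"
  using pers_smap_hom[OF assms(1,2)] assms(3) by (auto simp: LinearCombinations.module_hom_def)

section \<open>The cokernel as a persistence module and its universal property\<close>

locale pers_cokernel =
  fixes U :: "('r::linorder, 'f::field, 'u) pmod" and V :: "('r, 'f, 'v) pmod" and \<phi>
  assumes hom: "pers_hom U V \<phi>"
begin

abbreviation "Q \<equiv> quotient_map U V \<phi>"
abbreviation "C \<equiv> coker U V \<phi>"

lemma pers_U: "persistence_module U" and pers_V: "persistence_module V"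
  using hom unfolding pers_hom_def by auto

lemma abelian_subgroup_image: "abelian_subgroup (pers_image U \<phi> t) (fibre V t)"
proof -
  have ab: "abelian_group (fibre U t)" "abelian_group (fibre V t)"
    using pers_fibre_module[OF pers_U] pers_fibre_module[OF pers_V] by (simp_all add: Module.module_def)
  have "group_hom (add_monoid (fibre U t)) (add_monoid (fibre V t)) (\<phi> t)"
    using ab[THEN abelian_group.a_group] pers_hom_closed[OF hom] pers_hom_add[OF hom]
    by (auto simp: group_hom_def group_hom_axioms_def hom_def)
  then have "additive_subgroup (pers_image U \<phi> t) (fibre V t)"
    using group_hom.img_is_subgroup[of "add_monoid (fibre U t)" "add_monoid (fibre V t)" "\<phi> t"]
    by (simp add: additive_subgroup_def pers_image_def)
  then show ?thesis using ab(2) by (rule abelian_subgroupI3)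
qed

lemma Q_self: "v \<in> carrier (fibre V t) \<Longrightarrow> v \<in> Q t v"
  unfolding quotient_map_def using abelian_subgroup.a_rcos_self[OF abelian_subgroup_image] .

lemma Q_mem: "w \<in> Q t v \<longleftrightarrow> (\<exists>u\<in>carrier (fibre U t). w = \<phi> t u \<oplus>\<^bsub>fibre V t\<^esub> v)"
  by (auto simp: quotient_map_def a_r_coset_def' pers_image_def)

lemma Q_eq_iff:
  assumes "v \<in> carrier (fibre V t)" "w \<in> carrier (fibre V t)"
  shows "Q t v = Q t w \<longleftrightarrow> (\<exists>u\<in>carrier (fibre U t). v = \<phi> t u \<oplus>\<^bsub>fibre V t\<^esub> w)"
  using Q_self[OF assms(1)] abelian_subgroup.a_repr_independence'[OF abelian_subgroup_image _ assms(2), of v]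
  unfolding Q_mem[symmetric] by (auto simp: quotient_map_def)

lemma carrier_C: "carrier (fibre C t) = Q t ` carrier (fibre V t)"
  by (auto simp: coker_def A_RCOSETS_def' quotient_map_def)

text \<open>The coset of \<open>v\<close> consists of the shifts of \<open>v\<close> by vectors
  \<open>\<phi> t u\<close>, so invariance under such shifts gives the common value used in
  \<open>coker\<close>.\<close>

lemma the_elem_Q:
  assumes v: "v \<in> carrier (fibre V t)"
    and f: "\<And>u. u \<in> carrier (fibre U t) \<Longrightarrow> f (\<phi> t u \<oplus>\<^bsub>fibre V t\<^esub> v) = f v"
  shows "the_elem (f ` Q t v) = f v"
proof (rule the_elem_image_unique)
  show "Q t v \<noteq> {}" using Q_self[OF v] by blast
  show "f w = f v" if "w \<in> Q t v" for w
    using that f by (auto simp: Q_mem)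
qed

lemma Q_zero: "\<zero>\<^bsub>fibre C t\<^esub> = Q t \<zero>\<^bsub>fibre V t\<^esub>"
proof -
  interpret abelian_subgroup "pers_image U \<phi> t" "fibre V t" by (rule abelian_subgroup_image)
  show ?thesis
    unfolding quotient_map_def by (simp add: coker_def a_subset)
qed

lemma Q_add:
  assumes "v \<in> carrier (fibre V t)" "w \<in> carrier (fibre V t)"
  shows "Q t v \<oplus>\<^bsub>fibre C t\<^esub> Q t w = Q t (v \<oplus>\<^bsub>fibre V t\<^esub> w)"
  using abelian_subgroup.a_rcos_sum[OF abelian_subgroup_image assms]
  by (simp add: coker_def quotient_map_def)

text \<open>Scaling turns a shift by \<open>\<phi> t u\<close> into a shift by the image of the
  scaled \<open>u\<close>.\<close>

lemma Q_smult:
  assumes v: "v \<in> carrier (fibre V t)"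
  shows "a \<odot>\<^bsub>fibre C t\<^esub> Q t v = Q t (a \<odot>\<^bsub>fibre V t\<^esub> v)"
proof -
  note DV = module_class_ringD[OF pers_fibre_module[OF pers_V, of t]]
    and DU = module_class_ringD[OF pers_fibre_module[OF pers_U, of t]]
  have "Q t (a \<odot>\<^bsub>fibre V t\<^esub> (\<phi> t u \<oplus>\<^bsub>fibre V t\<^esub> v)) = Q t (a \<odot>\<^bsub>fibre V t\<^esub> v)"
    if u: "u \<in> carrier (fibre U t)" for u
  proof -
    have "a \<odot>\<^bsub>fibre V t\<^esub> (\<phi> t u \<oplus>\<^bsub>fibre V t\<^esub> v) = \<phi> t (a \<odot>\<^bsub>fibre U t\<^esub> u) \<oplus>\<^bsub>fibre V t\<^esub> a \<odot>\<^bsub>fibre V t\<^esub> v"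
      using u v pers_hom_closed[OF hom u] by (simp add: DV(9) pers_hom_smult[OF hom])
    then show ?thesis
      using u v pers_hom_closed[OF hom u]
      by (subst Q_eq_iff) (auto intro!: DV(2,3) DU(3) pers_hom_closed[OF hom])
  qed
  then show ?thesis
    using the_elem_Q[OF v, of "\<lambda>v. Q t (a \<odot>\<^bsub>fibre V t\<^esub> v)"] by (simp add: coker_def)
qed

text \<open>Naturality turns a shift by \<open>\<phi> s u\<close> into a shift by the image of
  \<open>smap U s t u\<close>.\<close>

lemma Q_smap:
  assumes v: "v \<in> carrier (fibre V s)" and st: "s \<le> t"
  shows "smap C s t (Q s v) = Q t (smap V s t v)"
proof -
  note DV = module_class_ringD[OF pers_fibre_module[OF pers_V]]
  have "Q t (smap V s t (\<phi> s u \<oplus>\<^bsub>fibre V s\<^esub> v)) = Q t (smap V s t v)"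
    if u: "u \<in> carrier (fibre U s)" for u
  proof -
    note cl = pers_hom_closed[OF hom u] pers_smap_closed[OF pers_U st u] pers_smap_closed[OF pers_V st v]
    have "smap V s t (\<phi> s u \<oplus>\<^bsub>fibre V s\<^esub> v) = \<phi> t (smap U s t u) \<oplus>\<^bsub>fibre V t\<^esub> smap V s t v"
      using u v cl by (simp add: pers_smap_add[OF pers_V st] pers_hom_natural[OF hom st])
    then show ?thesis
      using cl by (subst Q_eq_iff) (auto intro!: DV(2) pers_hom_closed[OF hom])
  qed
  then show ?thesis
    using the_elem_Q[OF v, of "\<lambda>v. Q t (smap V s t v)"] by (simp add: coker_def)
qed

lemma persistence_module_C: "persistence_module C"
  unfolding persistence_module_def vectorspace_iff_module
proof (intro conjI allI impI ballI)
  note DV = module_class_ringD[OF pers_fibre_module[OF pers_V]]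
  fix t
  show "module class_ring (fibre C t)"
    by (rule module_surj_image[OF pers_fibre_module[OF pers_V, of t], of "Q t"])
      (simp_all add: carrier_C Q_zero Q_add Q_smult)
  show "smap C t t c = c" if "c \<in> carrier (fibre C t)" for c
    using that by (auto simp: carrier_C Q_smap pers_smap_id[OF pers_V])
  fix s
  show "smap C s t \<in> LinearCombinations.module_hom class_ring (fibre C s) (fibre C t)" if "s \<le> t"
    using that pers_smap[OF pers_V that]
    by (intro module_homI) (auto simp: carrier_C Q_smap Q_add Q_smult DV(2,3))
  fix r c
  assume rs: "r \<le> s" and st: "s \<le> t" and "c \<in> carrier (fibre C r)"
  then obtain v where v: "v \<in> carrier (fibre V r)" "c = Q r v" by (auto simp: carrier_C)
  then show "smap C s t (smap C r s c) = smap C r t c"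
    using rs st pers_smap_closed[OF pers_V rs] pers_smap_comp[OF pers_V rs st]
    by (simp add: Q_smap order.trans[OF rs st])
qed

lemma pers_hom_Q: "pers_hom V C Q"
  unfolding pers_hom_def
proof (intro conjI allI impI ballI pers_V persistence_module_C)
  show "Q t \<in> LinearCombinations.module_hom class_ring (fibre V t) (fibre C t)" for t
    by (intro module_homI) (simp_all add: carrier_C Q_add Q_smult)
  show "Q t (smap V s t v) = smap C s t (Q s v)" if "s \<le> t" "v \<in> carrier (fibre V s)" for s t v
    using that by (simp add: Q_smap)
qed

text \<open>First isomorphism theorem. \<open>ker\<close> is stated for pairs of vectors to match
  \<open>Q_eq_iff\<close>, so it gives both well-definedness and injectivity of the induced
  map.\<close>

lemma pers_iso_cokernel:
  assumes g: "pers_hom V W g"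
    and surj: "\<And>t. g t ` carrier (fibre V t) = carrier (fibre W t)"
    and ker: "\<And>t v w. v \<in> carrier (fibre V t) \<Longrightarrow> w \<in> carrier (fibre V t) \<Longrightarrow>
      g t v = g t w \<longleftrightarrow> (\<exists>u\<in>carrier (fibre U t). v = \<phi> t u \<oplus>\<^bsub>fibre V t\<^esub> w)"
  shows "\<exists>\<gamma>. pers_iso C W \<gamma> \<and> (\<forall>t. \<forall>v\<in>carrier (fibre V t). \<gamma> t (Q t v) = g t v)"
proof -
  define \<gamma> where "\<gamma> t c = the_elem (g t ` c)" for t c
  note DV = module_class_ringD[OF pers_fibre_module[OF pers_V]]
  have \<gamma>: "\<gamma> t (Q t v) = g t v" if v: "v \<in> carrier (fibre V t)" for t v
    unfolding \<gamma>_def using pers_hom_closed[OF hom] v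
    by (intro the_elem_Q) (auto simp: ker DV(2))
  have "pers_hom C W \<gamma>"
    unfolding pers_hom_def
  proof (intro conjI allI impI ballI persistence_module_C)
    show "persistence_module W" using g unfolding pers_hom_def by blast
    show "\<gamma> t \<in> LinearCombinations.module_hom class_ring (fibre C t) (fibre W t)" for t
      by (intro module_homI)
        (auto simp: carrier_C Q_add Q_smult \<gamma> DV(2,3) pers_hom_closed[OF g] pers_hom_add[OF g] pers_hom_smult[OF g])
    show "\<gamma> t (smap C s t c) = smap W s t (\<gamma> s c)" if "s \<le> t" "c \<in> carrier (fibre C s)" for s t c
      using that by (auto simp: carrier_C Q_smap \<gamma> pers_smap_closed[OF pers_V] pers_hom_natural[OF g])
  qed
  moreover have "bij_betw (\<gamma> t) (carrier (fibre C t)) (carrier (fibre W t))" for t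
    unfolding bij_betw_def
  proof
    show "inj_on (\<gamma> t) (carrier (fibre C t))"
      unfolding carrier_C by (rule inj_onI) (elim imageE, simp add: \<gamma> ker Q_eq_iff)
    show "\<gamma> t ` carrier (fibre C t) = carrier (fibre W t)"
      unfolding carrier_C image_image surj[symmetric] by (rule image_cong) (simp_all add: \<gamma>)
  qed
  ultimately have "pers_iso C W \<gamma>"
    unfolding pers_iso_def by blast
  with \<gamma> show ?thesis by blast
qed

end

section \<open>Coordinates\<close>

locale interval_coordinates =
  fixes A :: "('r::linorder, 'f::field, 'v) pmod" and K :: "'k set" and a c :: "'k \<Rightarrow> 'r cut"
    and \<alpha> :: "'r \<Rightarrow> 'v \<Rightarrow> 'k \<Rightarrow> 'f"
  assumes decomposition: "interval_decomposition A K a c \<alpha>"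
begin

definition coord_inv :: "'r \<Rightarrow> ('k \<Rightarrow> 'f) \<Rightarrow> 'v" where
  "coord_inv t = inv_into (carrier (fibre A t)) (\<alpha> t)"

definition coords :: "'r \<Rightarrow> ('k \<Rightarrow> 'f) set" where
  "coords t = {v \<in> extensional K. \<forall>k\<in>K. v k \<noteq> 0 \<longrightarrow> t \<in> interval (a k) (c k)}"

lemma finite_index: "finite K"
  and bars: "k \<in> K \<Longrightarrow> a k \<le> c k"
  and iso: "pers_iso A (interval_sum K a c) \<alpha>"
  using decomposition unfolding interval_decomposition_def by auto

lemma coord_hom: "pers_hom A (interval_sum K a c) \<alpha>"
  using iso unfolding pers_iso_def by blast

lemma pers_A: "persistence_module A"
  using coord_hom unfolding pers_hom_def by blast

lemma bij: "bij_betw (\<alpha> t) (carrier (fibre A t)) (coords t)"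
  using iso unfolding pers_iso_def interval_sum_fibre(1)[OF finite_index] coords_def by blast

lemma coord_eq_iff: "v \<in> carrier (fibre A t) \<Longrightarrow> w \<in> carrier (fibre A t) \<Longrightarrow> \<alpha> t v = \<alpha> t w \<longleftrightarrow> v = w"
  using bij[of t] by (auto simp: bij_betw_def inj_on_eq_iff)

lemma coord_closed: "v \<in> carrier (fibre A t) \<Longrightarrow> \<alpha> t v \<in> coords t"
  using bij[of t] by (auto simp: bij_betw_def)

lemma coord_inv_closed: "v \<in> coords t \<Longrightarrow> coord_inv t v \<in> carrier (fibre A t)"
  and coord_coord_inv: "v \<in> coords t \<Longrightarrow> \<alpha> t (coord_inv t v) = v"
  using bij[of t] unfolding coord_inv_def bij_betw_def by (auto simp: inv_into_into f_inv_into_f)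

lemma coord_add:
  "v \<in> carrier (fibre A t) \<Longrightarrow> w \<in> carrier (fibre A t) \<Longrightarrow> \<alpha> t (v \<oplus>\<^bsub>fibre A t\<^esub> w) = (\<lambda>k\<in>K. \<alpha> t v k + \<alpha> t w k)"
  and coord_smult: "v \<in> carrier (fibre A t) \<Longrightarrow> \<alpha> t (x \<odot>\<^bsub>fibre A t\<^esub> v) = (\<lambda>k\<in>K. x * \<alpha> t v k)"
  and coord_smap: "s \<le> t \<Longrightarrow> v \<in> carrier (fibre A s) \<Longrightarrow> \<alpha> t (smap A s t v) =
    (\<lambda>k\<in>K. if s \<in> interval (a k) (c k) \<and> t \<in> interval (a k) (c k) then \<alpha> s v k else 0)"
  using coord_hom by (simp_all add: pers_hom_add pers_hom_smult pers_hom_natural interval_sum_fibre[OF finite_index])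

text \<open>Coordinates of bars not alive at \<open>t\<close> vanish, so only the alive ones have to
  be compared.\<close>

lemma coord_eqI:
  assumes "v \<in> carrier (fibre A t)" "w \<in> carrier (fibre A t)"
    and "\<And>k. k \<in> K \<Longrightarrow> t \<in> interval (a k) (c k) \<Longrightarrow> \<alpha> t v k = \<alpha> t w k"
  shows "v = w"
proof -
  have "\<alpha> t v k = \<alpha> t w k" for k
    using assms(3)[of k] coord_closed[OF assms(1)] coord_closed[OF assms(2)]
    by (cases "k \<in> K") (auto simp: coords_def extensional_def)
  then have "\<alpha> t v = \<alpha> t w" by auto
  then show ?thesis using coord_eq_iff assms by blast
qed

end

text \<open>\<open>matrix_represents\<close> prescribes the values on multiples of single
  generators, at times in both bars. Additivity extends this to every \<open>u\<close>; bars of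
  \<open>A\<close> not alive at \<open>t\<close> have coordinate 0.\<close>

lemma matrix_represents_coords:
  fixes X :: "'i \<Rightarrow> 'j \<Rightarrow> 'f::field"
  assumes X: "matrix_represents A J a' c' \<alpha> B I a c \<beta> \<phi> X"
    and u: "u \<in> carrier (fibre A t)" and i: "i \<in> I" "t \<in> interval (a i) (c i)"
  shows "\<beta> t (\<phi> t u) i = (\<Sum>j\<in>J. X i j * \<alpha> t u j)"
proof -
  interpret A: interval_coordinates A J a' c' \<alpha>
    by unfold_locales (use X in \<open>simp add: matrix_represents_def\<close>)
  interpret B: interval_coordinates B I a c \<beta>
    by unfold_locales (use X in \<open>simp add: matrix_represents_def\<close>)
  have \<phi>: "pers_hom A B \<phi>" using X by (simp add: matrix_represents_def)
  note DA = module_class_ringD[OF pers_fibre_module[OF A.pers_A, of t]]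
  \<comment> \<open>The \<open>i\<close>-th coordinate of \<open>\<phi> t\<close> as a function of
    source coordinates, shown to be additive.\<close>
  define G where "G v = \<beta> t (\<phi> t (A.coord_inv t v)) i" for v
  have G_add: "G (\<lambda>j\<in>J. v j + w j) = G v + G w" if "v \<in> A.coords t" "w \<in> A.coords t" for v w
  proof -
    note cl = A.coord_inv_closed[OF that(1)] A.coord_inv_closed[OF that(2)]
    have "(\<lambda>j\<in>J. v j + w j) \<in> A.coords t"
      using that by (auto simp: A.coords_def)
    then have "A.coord_inv t (\<lambda>j\<in>J. v j + w j) = A.coord_inv t v \<oplus>\<^bsub>fibre A t\<^esub> A.coord_inv t w"
      using cl that by (subst A.coord_eq_iff[symmetric, where t = t])
        (auto simp: A.coord_inv_closed A.coord_coord_inv A.coord_add DA(2))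
    then show ?thesis
      using cl i by (simp add: G_def pers_hom_add[OF \<phi>] B.coord_add pers_hom_closed[OF \<phi>])
  qed
  have zero: "(\<lambda>j\<in>J. 0) \<in> A.coords t" by (simp add: A.coords_def)
  have "(\<lambda>j\<in>J. (\<lambda>j\<in>J. 0) j + (\<lambda>j\<in>J. 0) j) = (\<lambda>j\<in>J. 0 :: 'f)"
    by auto
  then have G_zero: "G (\<lambda>j\<in>J. 0) = 0"
    using G_add[OF zero zero] by (simp only: add_cancel_right_right)
  have G_single: "G (\<lambda>k\<in>J. if k = j then v j else 0) = X i j * v j" if "v \<in> A.coords t" "j \<in> J" for v j
  proof (cases "t \<in> interval (a' j) (c' j)")
    case True
    then show ?thesis
      using X i that unfolding matrix_represents_def G_def A.coord_inv_def
      by (simp add: interval_sum_fibre[OF A.finite_index])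
  next
    case False
    then have "v j = 0" using that by (auto simp: A.coords_def)
    moreover have "(\<lambda>k\<in>J. if k = j then 0 else 0) = (\<lambda>j\<in>J. 0 :: 'f)" by auto
    ultimately show ?thesis by (simp only: G_zero mult_zero_right)
  qed
  \<comment> \<open>Induction on \<open>K\<close>, adding one generator at a time up to
    \<open>K = J\<close>.\<close>
  have "G (\<lambda>j\<in>J. if j \<in> K then v j else 0) = (\<Sum>j\<in>K. X i j * v j)"
    if v: "v \<in> A.coords t" and K: "K \<subseteq> J" for v K
    using finite_subset[OF K A.finite_index] K
  proof (induction K rule: finite_induct)
    case empty
    show ?case by (simp only: empty_iff if_False G_zero sum.empty)
  next
    case (insert j K)
    have "(\<lambda>k\<in>J. if k \<in> insert j K then v k else 0) =
        (\<lambda>k\<in>J. (\<lambda>k\<in>J. if k = j then v j else 0) k + (\<lambda>k\<in>J. if k \<in> K then v k else 0) k)"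
      using insert.hyps by (auto simp: restrict_def)
    then have "G (\<lambda>k\<in>J. if k \<in> insert j K then v k else 0) =
        G (\<lambda>k\<in>J. (\<lambda>k\<in>J. if k = j then v j else 0) k + (\<lambda>k\<in>J. if k \<in> K then v k else 0) k)"
      by (rule arg_cong)
    also have "\<dots> = G (\<lambda>k\<in>J. if k = j then v j else 0) + G (\<lambda>k\<in>J. if k \<in> K then v k else 0)"
      using v by (intro G_add) (auto simp: A.coords_def extensional_def split: if_splits)
    finally show ?case
      using insert.prems
      by (simp only: G_single[OF v] insert.IH sum.insert[OF insert.hyps] insert_subset)
  qed
  from this[OF A.coord_closed[OF u] subset_refl]
  have "G (\<alpha> t u) = (\<Sum>j\<in>J. X i j * \<alpha> t u j)"
    using A.coord_closed[OF u] by (simp add: A.coords_def extensional_restrict cong: restrict_cong)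
  moreover have "A.coord_inv t (\<alpha> t u) = u"
    using A.coord_eq_iff[OF A.coord_inv_closed u] A.coord_coord_inv A.coord_closed[OF u] by blast
  ultimately show ?thesis by (simp add: G_def)
qed

theorem theorem9p4:
  fixes U :: "('r::linorder, 'f::field, 'u) pmod" and V :: "('r, 'f, 'v) pmod"
    and J :: "'j set" and b' d' :: "'j \<Rightarrow> 'r cut" and \<alpha> :: "'r \<Rightarrow> 'u \<Rightarrow> 'j \<Rightarrow> 'f"
    and I :: "'i set" and b d :: "'i \<Rightarrow> 'r cut" and \<beta> :: "'r \<Rightarrow> 'v \<Rightarrow> 'i \<Rightarrow> 'f"
    and \<phi> :: "'r \<Rightarrow> 'u \<Rightarrow> 'v" and X :: "'i \<Rightarrow> 'j \<Rightarrow> 'f"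
    and rJ :: "'j rel" and rI rows cols :: "'i rel"
  assumes U: "interval_decomposition U J b' d' \<alpha>"
    and V: "interval_decomposition V I b d \<beta>"
    and rJ: "ordered_by J b' rJ"
    and rI: "reverse_ordered_by I d rI"
    and \<phi>: "pers_hom U V \<phi>"
    and X: "matrix_represents U J b' d' \<alpha> V I b d \<beta> \<phi> X"
  defines "S \<equiv> reduction_mat I rI J rJ X"
  defines "SX \<equiv> row_reduced I rI J rJ X"
  defines "p' \<equiv> pivot J rJ SX"
  defines "P \<equiv> {i\<in>I. has_pivot J SX i \<and> b' (p' i) < d i}"
  defines "d'' \<equiv> \<lambda>i. if i \<in> P then b' (p' i) else d i"
  assumes rows: "reverse_ordered_by I d'' rows"
    and cols: "ordered_by I b cols"
  defines "S' \<equiv> row_reduced I rows I cols S"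
  defines "q' \<equiv> pivot I cols S'"
  shows "(\<forall>i\<in>I. b (q' i) \<le> d'' i) \<and>
    (\<exists>\<gamma>. pers_iso (coker U V \<phi>) (interval_sum I (\<lambda>i. b (q' i)) d'') \<gamma> \<and>
         matrix_represents V I b d \<beta> (coker U V \<phi>) I (\<lambda>i. b (q' i)) d'' \<gamma>
           (quotient_map U V \<phi>) S')"
proof -
  interpret U: interval_coordinates U J b' d' \<alpha> by unfold_locales (rule U)
  interpret V: interval_coordinates V I b d \<beta> by unfold_locales (rule V)
  interpret C: pers_cokernel U V \<phi> by unfold_locales (rule \<phi>)
  \<comment> \<open>Births, deaths and thresholds are now cuts. The two conditions shown are
    contrapositives of the vanishing conditions on \<open>X\<close>.\<close>
  interpret R: reduced_presentation J I b' d' b d X rJ rI rows cols S SX p' P d''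
      "reduction_mat I rows I cols S" S' q'
  proof
    show "b i \<le> b' j" if "i \<in> I" "j \<in> J" "X i j \<noteq> 0" for i j
      using X that unfolding matrix_represents_def by (meson not_le)
    show "d i \<le> d' j" if "i \<in> I" "j \<in> J" "X i j \<noteq> 0" for i j
      using X that unfolding matrix_represents_def by (meson not_le)
  qed (use U.finite_index V.finite_index V.bars rJ rI rows cols in
      \<open>simp_all add: S_def SX_def p'_def P_def d''_def S'_def q'_def\<close>)

  \<comment> \<open>The map from \<open>V\<close> to the interval sum\<close>
  let ?W = "interval_sum I (\<lambda>i. b (q' i)) d'' :: ('r, 'f, 'i \<Rightarrow> 'f) pmod"
  note W = interval_sum_fibre[OF V.finite_index, where 'f = 'f, of "\<lambda>i. b (q' i)" d'']
  note DV = module_class_ringD[OF pers_fibre_module[OF V.pers_A]]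
  \<comment> \<open>\<open>S'\<close> applied to coordinates, with rows outside their bar set to 0.
    It will turn out to be the quotient map in coordinates.\<close>
  define g where "g t v = (\<lambda>i\<in>I. if t \<in> interval (b (q' i)) (d'' i) then \<Sum>k\<in>I. S' i k * \<beta> t v k else 0)" for t v
  have in_V: "\<beta> t v k \<noteq> 0 \<Longrightarrow> k \<in> I \<Longrightarrow> b k \<le> cut_below t \<and> cut_below t < d k"
    if "v \<in> carrier (fibre V t)" for t v k
    using V.coord_closed[OF that] by (auto simp: V.coords_def in_interval_iff)
  have g_add: "g t (v \<oplus>\<^bsub>fibre V t\<^esub> w) = (\<lambda>i\<in>I. g t v i + g t w i)"
    if "v \<in> carrier (fibre V t)" "w \<in> carrier (fibre V t)" for t v w
    using that by (auto simp: g_def V.coord_add restrict_def algebra_simps sum.distrib cong: sum.cong)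
  have g_smult: "g t (x \<odot>\<^bsub>fibre V t\<^esub> v) = (\<lambda>i\<in>I. x * g t v i)"
    if "v \<in> carrier (fibre V t)" for t v x
    using that by (auto simp: g_def V.coord_smult restrict_def sum_distrib_left mult.left_commute cong: sum.cong)
  have g_natural: "g t (smap V s t v) = smap ?W s t (g s v)"
    if st: "s \<le> t" and v: "v \<in> carrier (fibre V s)" for s t v
  proof
    fix i
    show "g t (smap V s t v) i = smap ?W s t (g s v) i"
    proof (cases "i \<in> I \<and> t \<in> interval (b (q' i)) (d'' i)")
      case True
      then have i: "i \<in> I" "cut_below t < d'' i" by (auto simp: in_interval_iff)
      \<comment> \<open>Only coordinates that die after \<open>t\<close> count; a nonzero one at
        \<open>s\<close> is born by \<open>s\<close>, so its bar contains both times and the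
        structure map preserves it.\<close>
      have "(\<Sum>k\<in>I. S' i k * \<beta> t (smap V s t v) k) = (\<Sum>k\<in>I. S' i k * \<beta> s v k)"
      proof (rule R.S'_restrict[OF i])
        fix k assume k: "k \<in> I" "cut_below t < d k"
        have "s \<in> interval (b k) (d k)" "t \<in> interval (b k) (d k)" if "\<beta> s v k \<noteq> 0"
        proof -
          show s: "s \<in> interval (b k) (d k)"
            using in_V[OF v that k(1)] by (simp add: in_interval_iff)
          then have "t \<in> upper (b k)"
            using st cut_less[of t "b k" s] by (auto simp: interval_def upper_eq)
          then show "t \<in> interval (b k) (d k)" using k by (simp add: in_interval_iff le_cut_below_iff)
        qed
        then show "\<beta> t (smap V s t v) k = \<beta> s v k"
          using k by (auto simp: V.coord_smap[OF st v])
      qed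
      \<comment> \<open>Row \<open>i\<close> is alive at \<open>t\<close>, so if it is not alive at
        the earlier time \<open>s\<close>, it is not yet born there.\<close>
      moreover have "(\<Sum>k\<in>I. S' i k * \<beta> s v k) = 0" if s: "s \<notin> interval (b (q' i)) (d'' i)"
      proof (rule R.S'_birth_zero[OF i(1)])
        have "s \<in> lower (d'' i)"
          using True st cut_less[of t "d'' i" s] by (auto simp: interval_def upper_eq dest: leD)
        then show "\<not> b (q' i) \<le> cut_below s" using s by (simp add: le_cut_below_iff interval_def)
      qed (use in_V[OF v] in blast)
      ultimately show ?thesis using True by (simp add: g_def W)
    next
      case False
      then show ?thesis by (auto simp: g_def W)
    qed
  qed
  have g_hom: "pers_hom V ?W g"
    unfolding pers_hom_def
  proof (intro conjI allI impI ballI V.pers_A persistence_module_interval_sum V.finite_index)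
    show "g t \<in> LinearCombinations.module_hom class_ring (fibre V t) (fibre ?W t)" for t
      by (intro module_homI) (simp_all add: W g_add g_smult, auto simp: g_def)
  qed (rule g_natural)

  \<comment> \<open>The kernel of \<open>g\<close> is the image of \<open>\<phi>\<close>\<close>
  have g_ker: "g t v = g t w \<longleftrightarrow> (\<exists>u\<in>carrier (fibre U t). v = \<phi> t u \<oplus>\<^bsub>fibre V t\<^esub> w)"
    if v: "v \<in> carrier (fibre V t)" and w: "w \<in> carrier (fibre V t)" for t v w
  proof
    assume eq: "g t v = g t w"
    define z where "z = v \<oplus>\<^bsub>fibre V t\<^esub> (- 1) \<odot>\<^bsub>fibre V t\<^esub> w"
    have z: "z \<in> carrier (fibre V t)" using v w by (simp add: z_def DV(2,3))
    have \<beta>z: "\<beta> t z k = \<beta> t v k - \<beta> t w k" if "k \<in> I" for k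
      using v w that by (simp add: z_def V.coord_add V.coord_smult DV(2,3))
    obtain c where c: "\<And>j. c j \<noteq> 0 \<Longrightarrow> j \<in> J \<and> b' j \<le> cut_below t \<and> cut_below t < d' j"
      and Xc: "\<And>i. i \<in> I \<Longrightarrow> cut_below t < d i \<Longrightarrow> \<beta> t z i = (\<Sum>j\<in>J. X i j * c j)"
    proof (rule R.kernel_in_image[of "\<beta> t z" "cut_below t"])
      show "b k \<le> cut_below t" if "k \<in> I" "\<beta> t z k \<noteq> 0" for k
        using in_V[OF z] that by blast
      fix i assume i: "i \<in> I" "b (q' i) \<le> cut_below t" "cut_below t < d'' i"
      then have "t \<in> interval (b (q' i)) (d'' i)" by (simp add: in_interval_iff)
      then have "(\<Sum>k\<in>I. S' i k * \<beta> t v k) = (\<Sum>k\<in>I. S' i k * \<beta> t w k)"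
        using fun_cong[OF eq, of i] i by (simp add: g_def)
      then show "(\<Sum>k\<in>I. S' i k * \<beta> t z k) = 0"
        by (simp add: \<beta>z right_diff_distrib sum_subtractf)
    qed (rule that)
    \<comment> \<open>\<open>c\<close> is supported on the bars of \<open>U\<close> alive at
      \<open>t\<close>, so it is the coordinate vector of an element of the fibre.\<close>
    define u where "u = U.coord_inv t (\<lambda>j\<in>J. c j)"
    have c_coords: "(\<lambda>j\<in>J. c j) \<in> U.coords t"
      using c by (auto simp: U.coords_def in_interval_iff)
    have u: "u \<in> carrier (fibre U t)" "\<alpha> t u = (\<lambda>j\<in>J. c j)"
      using U.coord_inv_closed[OF c_coords] U.coord_coord_inv[OF c_coords] by (auto simp: u_def)
    have \<phi>u: "\<phi> t u \<in> carrier (fibre V t)" by (rule pers_hom_closed[OF \<phi> u(1)])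
    have "v = \<phi> t u \<oplus>\<^bsub>fibre V t\<^esub> w"
    proof (rule V.coord_eqI[OF v DV(2)[OF \<phi>u w]])
      fix i assume i: "i \<in> I" "t \<in> interval (b i) (d i)"
      have "\<beta> t (\<phi> t u) i = \<beta> t z i"
        using matrix_represents_coords[OF X u(1) i] Xc i by (simp add: u(2) in_interval_iff)
      then show "\<beta> t v i = \<beta> t (\<phi> t u \<oplus>\<^bsub>fibre V t\<^esub> w) i"
        using i by (simp add: V.coord_add[OF \<phi>u w] \<beta>z)
    qed
    then show "\<exists>u\<in>carrier (fibre U t). v = \<phi> t u \<oplus>\<^bsub>fibre V t\<^esub> w" using u by blast
  next
    assume "\<exists>u\<in>carrier (fibre U t). v = \<phi> t u \<oplus>\<^bsub>fibre V t\<^esub> w"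
    then obtain u where u: "u \<in> carrier (fibre U t)" and v_eq: "v = \<phi> t u \<oplus>\<^bsub>fibre V t\<^esub> w" by blast
    have \<phi>u: "\<phi> t u \<in> carrier (fibre V t)" by (rule pers_hom_closed[OF \<phi> u])
    have "g t (\<phi> t u) i = 0" if "i \<in> I" for i
    proof -
      have "(\<Sum>k\<in>I. S' i k * \<beta> t (\<phi> t u) k) = 0" if "cut_below t < d'' i"
      proof (rule R.image_in_kernel[where c = "\<alpha> t u" and x = "cut_below t"])
        show "cut_below t < d k" if "k \<in> I" "\<beta> t (\<phi> t u) k \<noteq> 0" for k
          using in_V[OF \<phi>u] that by blast
        show "b' j \<le> cut_below t" if "j \<in> J" "\<alpha> t u j \<noteq> 0" for j
          using U.coord_closed[OF u] that by (auto simp: U.coords_def in_interval_iff)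
        fix k assume k: "k \<in> I" "cut_below t < d k"
        show "\<beta> t (\<phi> t u) k = (\<Sum>j\<in>J. X k j * \<alpha> t u j)"
        proof (cases "b k \<le> cut_below t")
          case True
          then show ?thesis
            using k by (intro matrix_represents_coords[OF X u]) (auto simp: in_interval_iff)
        next
          case False
          \<comment> \<open>Row \<open>k\<close> is not yet born at \<open>t\<close>. A nonzero
            \<open>X k j\<close> forces column \<open>j\<close> to be born no earlier, so both sides
            of the equation vanish.\<close>
          have "X k j * \<alpha> t u j = 0" if "j \<in> J" for j
            using R.X_birth[OF k(1) that] U.coord_closed[OF u] that False
            by (cases "X k j = 0") (auto simp: U.coords_def in_interval_iff)
          then have "(\<Sum>j\<in>J. X k j * \<alpha> t u j) = 0" by simp
          then show ?thesis using in_V[OF \<phi>u _ k(1)] False by auto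
        qed
      qed (use \<open>i \<in> I\<close> that in auto)
      then show ?thesis using \<open>i \<in> I\<close> by (simp add: g_def in_interval_iff)
    qed
    then show "g t v = g t w"
      unfolding v_eq g_add[OF \<phi>u w] by (auto simp: restrict_def g_def)
  qed

  \<comment> \<open>Surjectivity of \<open>g\<close>\<close>
  have g_surj: "g t ` carrier (fibre V t) = carrier (fibre ?W t)" for t
  proof
    show "g t ` carrier (fibre V t) \<subseteq> carrier (fibre ?W t)"
      using pers_hom_closed[OF g_hom] by blast
    show "carrier (fibre ?W t) \<subseteq> g t ` carrier (fibre V t)"
    proof
      fix w assume "w \<in> carrier (fibre ?W t)"
      then have w: "w \<in> extensional I" "\<And>i. i \<in> I \<Longrightarrow> w i \<noteq> 0 \<Longrightarrow> t \<in> interval (b (q' i)) (d'' i)"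
        by (auto simp: W)
      obtain v where v: "\<And>k. v k \<noteq> 0 \<Longrightarrow> k \<in> I \<and> b k \<le> cut_below t \<and> cut_below t < d k"
        and S'v: "\<And>i. i \<in> I \<Longrightarrow> cut_below t < d'' i \<Longrightarrow> (\<Sum>k\<in>I. S' i k * v k) = w i"
        by (rule R.S'_surj[of w "cut_below t"]) (use w in \<open>auto simp: in_interval_iff\<close>)
      have v_coords: "(\<lambda>k\<in>I. v k) \<in> V.coords t"
        using v by (auto simp: V.coords_def in_interval_iff)
      have "g t (V.coord_inv t (\<lambda>k\<in>I. v k)) = w"
      proof
        fix i
        show "g t (V.coord_inv t (\<lambda>k\<in>I. v k)) i = w i"
        proof (cases "i \<in> I \<and> t \<in> interval (b (q' i)) (d'' i)")
          case True
          then show ?thesis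
            using S'v[of i] by (simp add: g_def V.coord_coord_inv[OF v_coords] in_interval_iff)
        next
          case False
          then have "w i = 0" if "i \<in> I"
            using w(2)[OF that] that by blast
          then show ?thesis
            using False by (cases "i \<in> I") (simp_all add: g_def extensional_arb[OF w(1)])
        qed
      qed
      then show "w \<in> g t ` carrier (fibre V t)"
        using V.coord_inv_closed[OF v_coords] by blast
    qed
  qed

  \<comment> \<open>The induced isomorphism and the matrix of the quotient map\<close>
  have "\<exists>\<gamma>. pers_iso C.C ?W \<gamma> \<and> (\<forall>t. \<forall>v\<in>carrier (fibre V t). \<gamma> t (C.Q t v) = g t v)"
    by (rule C.pers_iso_cokernel[OF g_hom g_surj g_ker])
  then obtain \<gamma> where \<gamma>: "pers_iso C.C ?W \<gamma>" and \<gamma>_Q: "\<And>t v. v \<in> carrier (fibre V t) \<Longrightarrow> \<gamma> t (C.Q t v) = g t v"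
    by blast
  have "matrix_represents V I b d \<beta> C.C I (\<lambda>i. b (q' i)) d'' \<gamma> C.Q S'"
    unfolding matrix_represents_def interval_decomposition_def[of C.C]
  proof (intro conjI ballI allI impI V V.finite_index \<gamma> C.pers_hom_Q R.birth_le_death)
    fix i j assume ij: "i \<in> I" "j \<in> I"
    show "S' i j = 0" if "b (q' i) > b j \<or> d'' i > d j"
      using R.S'_birth[OF ij] R.S'_death[OF ij] that by (meson not_le)
    fix t and x :: 'f
    assume t: "t \<in> interval (b (q' i)) (d'' i) \<inter> interval (b j) (d j)"
    \<comment> \<open>Both bars contain \<open>t\<close>, so this generator lies in the fibre and
      the cut-off in \<open>g\<close> does not affect row \<open>i\<close>.\<close>
    let ?e = "\<lambda>k\<in>I. if k = j then x else 0"
    have e: "?e \<in> V.coords t" using t by (auto simp: V.coords_def split: if_splits)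
    have "\<gamma> t (C.Q t (V.coord_inv t ?e)) i = (\<Sum>k\<in>I. S' i k * ?e k)"
      using t ij by (simp add: \<gamma>_Q V.coord_inv_closed[OF e] V.coord_coord_inv[OF e] g_def)
    also have "\<dots> = (\<Sum>k\<in>I. if k = j then S' i j * x else 0)"
      by (intro sum.cong) auto
    finally show "\<gamma> t (C.Q t (inv_into (carrier (fibre V t)) (\<beta> t)
        (pers_sum_incl I (\<lambda>k. interval_module (b k) (d k)) t j x))) i = S' i j * x"
      using ij V.finite_index by (simp add: interval_sum_fibre(6) V.coord_inv_def)
  qed
  then show ?thesis using \<gamma> R.birth_le_death by blast
qed

end
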